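(* Let $d=1$, let $\ell:\mathbb R^2\to\mathbb R$ be convex and $1$-Lipschitz in its second argument, and let $h_t:=\max_{s\le t}|x_s|$, $t\ge1$. If $(\widehat u_t)$ are the outputs of the modified FreeRange algorithm defined in the context, then for all $w\in\mathbb R$, all $T\ge1$, all $(x_t,y_t)\subset\mathbb R^2$ such that $h_1=|x_1|>0$, and all $\delta_t\in\partial^{(0,1)}\ell(y_t,x_t\widehat u_t)$, $t\in\{1,\dots,T\}$, $$\sum_{t=1}^T\delta_tx_t\cdot(\widehat u_t-w)\le 2|w|\sqrt{V_T\ln_+(2|w|^2V_Tc_T)}+h_T|w|\left(14\ln_+\bigl(2|w|\sqrt{2V_Tc_T}\bigr)+1\right)+2+\ln B_T,$$ where $V_T:=|x_1|^2+\sum_{t=1}^T\delta_t^2x_t^2$, $c_T:=2B_T^2\sum_{t=1}^T\left(\sum_{s=1}^t\frac{|x_s|}{h_s}\right)^2\le T^5$, and $B_T:=\sum_{s=1}^T\frac{|x_s|}{h_s}\le T$.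
   Context: $\ln_+(\cdot):=\max\{0,\ln(\cdot)\}$ (with $\ln_+0=0$). $\partial^{(0,1)}\ell(y,\hat y)$ denotes the subdifferential of $\ell$ with respect to its second argument at $(y,\hat y)$. Protocol: in round $t\ge1$, $x_t\in\mathbb R$ is revealed, the learner outputs $\widehat u_t\in\mathbb R$ (predicting $\widehat y_t=x_t\widehat u_t$), then $y_t\in\mathbb R$ is revealed and a subgradient $\delta_t\in\partial^{(0,1)}\ell(y_t,x_t\widehat u_t)$ is observed; set $g_t:=\delta_tx_t$. Modified FreeRange (in dimension $1$): initialize $\tau=1$. For $t=1,2,\dots$: observe $h_t=\max_{s\le t}|x_s|$; if $h_t/h_\tau>\sum_{s=1}^{t-1}|x_s|/h_s+1$, set $\tau=t$. Then, with $V:=h_\tau^2+\sum_{s=\tau}^{t-1}g_s^2$ and $G:=\sum_{s=\tau}^{t-1}g_s$, let $$\widehat w_t:=-G\cdot\frac{(2V+h_t|G|)\,h_\tau^2}{2(V+h_t|G|)^2\sqrt V}\cdot\exp\left(\frac{G^2}{2V+2h_t|G|}\right)$$ and output $\widehat u_t:=\widehat w_t\cdot\left(h_\tau\cdot\sum_{s=1}^{\tau}\frac{|x_s|}{h_s}\right)^{-1}$.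
   Formalization: The bound c_T ≤ T^5 fails for T = 1, 2, 3 (if all |x_t| are equal, c_1 = 2, c_2 = 40, c_3 = 252), so it is stated for T ≥ 4 only, together with c_T ≤ 2T^5 for all T ≥ 1. *)

theory Defs
  imports "HOL-Analysis.Analysis"
begin

text \<open>Rounds are numbered from 1; the value of a sequence at index 0 is never used.\<close>

text \<open>The explicit case distinction gives \<open>ln_plus 0 = 0\<close> without relying on the value of \<open>ln\<close>
  outside its domain.\<close>

definition ln_plus :: "real \<Rightarrow> real" where
  "ln_plus z = (if z > 0 then max 0 (ln z) else 0)"

definition subdiff_snd :: "(real \<Rightarrow> real \<Rightarrow> real) \<Rightarrow> real \<Rightarrow> real \<Rightarrow> real set" where
  "subdiff_snd l y v = {d. \<forall>z. l y z \<ge> l y v + d * (z - v)}"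

definition hmax :: "(nat \<Rightarrow> real) \<Rightarrow> nat \<Rightarrow> real" where
  "hmax x t = Max ((\<lambda>s. \<bar>x s\<bar>) ` {1..t})"

definition B_sum :: "(nat \<Rightarrow> real) \<Rightarrow> nat \<Rightarrow> real" where
  "B_sum x t = (\<Sum>s = 1..t. \<bar>x s\<bar> / hmax x s)"

text \<open>\<open>restart x t\<close> is the value of \<open>\<tau>\<close> after the update in round \<open>t\<close>; \<open>restart x 0\<close> is its
  initial value. In round \<open>Suc n\<close> the restart test uses the sum over the rounds \<open>1..n\<close>.\<close>

primrec restart :: "(nat \<Rightarrow> real) \<Rightarrow> nat \<Rightarrow> nat" where
  "restart x 0 = 1"
| "restart x (Suc n) =
    (if hmax x (Suc n) / hmax x (restart x n) > B_sum x n + 1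
     then Suc n else restart x n)"

text \<open>The outputs are functions of the sequences \<open>x\<close> and \<open>\<delta>\<close>, with \<open>g\<^sub>s = \<delta>\<^sub>s x\<^sub>s\<close>. In round \<open>t\<close> they
  depend on \<open>x\<close> only through the rounds \<open>1..t\<close> and on \<open>\<delta>\<close> only through the rounds before \<open>t\<close>, so
  \<open>\<delta>\<^sub>t\<close> may be chosen depending on the output of round \<open>t\<close>.\<close>

definition w_hat :: "(nat \<Rightarrow> real) \<Rightarrow> (nat \<Rightarrow> real) \<Rightarrow> nat \<Rightarrow> real" where
  "w_hat x \<delta> t =
    (let \<tau> = restart x t;
         h = hmax x t;
         V = (hmax x \<tau>)\<^sup>2 + (\<Sum>s = \<tau>..<t. (\<delta> s * x s)\<^sup>2);
         G = (\<Sum>s = \<tau>..<t. \<delta> s * x s)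
     in - G * (((2 * V + h * \<bar>G\<bar>) * (hmax x \<tau>)\<^sup>2) / (2 * (V + h * \<bar>G\<bar>)\<^sup>2 * sqrt V))
          * exp (G\<^sup>2 / (2 * V + 2 * h * \<bar>G\<bar>)))"

definition u_hat :: "(nat \<Rightarrow> real) \<Rightarrow> (nat \<Rightarrow> real) \<Rightarrow> nat \<Rightarrow> real" where
  "u_hat x \<delta> t =
    w_hat x \<delta> t * inverse (hmax x (restart x t) * B_sum x (restart x t))"

definition V_sum :: "(nat \<Rightarrow> real) \<Rightarrow> (nat \<Rightarrow> real) \<Rightarrow> nat \<Rightarrow> real" where
  "V_sum x \<delta> T = \<bar>x 1\<bar>\<^sup>2 + (\<Sum>t = 1..T. (\<delta> t)\<^sup>2 * (x t)\<^sup>2)"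

definition c_sum :: "(nat \<Rightarrow> real) \<Rightarrow> nat \<Rightarrow> real" where
  "c_sum x T = 2 * (B_sum x T)\<^sup>2 * (\<Sum>t = 1..T. (B_sum x t)\<^sup>2)"

end

theory Submission
  imports Defs
begin

text \<open>Between two restarts the prediction \<open>w_hat\<close> is minus the derivative, in the gradient sum \<open>G\<close>, of the
  potential \<open>h\<^sub>\<tau>\<^sup>2 exp (G\<^sup>2 / (2 V + 2 h |G|)) / sqrt V\<close>, and this potential decreases along the rounds up
  to the linear term \<open>g w_hat\<close>. Hence an epoch starting at \<open>\<tau>\<close> costs at most \<open>1 / B\<^sub>\<tau>\<close> minus the rescaled
  potential, and the convex conjugate of the potential pays for the comparator. The terms \<open>1 / B\<^sub>\<tau>\<close>
  sum to at most \<open>1 + ln B\<^sub>T\<close>, because \<open>B\<close> grows by exactly one at each restart. Only the last two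
  epochs need the conjugate bound: the restart rule makes the total length of all the earlier rounds
  at most \<open>h\<^sub>T\<close>. The logarithm in the conjugate involves \<open>|w| |G|\<close>; when this product is at most
  \<open>1 / 2\<close> the comparator term is trivial, and otherwise \<open>|w| |G| \<le> 2 w\<^sup>2 G\<^sup>2\<close>, which is what
  allows \<open>V\<^sub>T c\<^sub>T\<close> inside the logarithm although the initial value \<open>h\<^sub>\<tau>\<^sup>2\<close> of \<open>V\<close> is not bounded by \<open>V\<^sub>T\<close>.\<close>

section \<open>The potential inequality\<close>

lemma ln_one_plus_ge_quadratic:
  fixes y :: real
  assumes "0 \<le> y"
  shows "y - y\<^sup>2 / 2 \<le> ln (1 + y)"
proof -
  let ?f = "\<lambda>t::real. ln (1 + t) - t + t\<^sup>2 / 2"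
  have "?f 0 \<le> ?f y"
  proof (rule DERIV_nonneg_imp_nondecreasing[OF assms])
    fix t :: real assume t: "0 \<le> t" "t \<le> y"
    have "(?f has_real_derivative (t\<^sup>2 / (1 + t))) (at t)"
      using t by (auto intro!: derivative_eq_intros simp: field_simps power2_eq_square)
    moreover have "0 \<le> t\<^sup>2 / (1 + t)" using t by simp
    ultimately show "\<exists>d. (?f has_real_derivative d) (at t) \<and> 0 \<le> d" by blast
  qed
  then show ?thesis by simp
qed

text \<open>To the left of 1 the plain quadratic lower bound of the logarithm fails; the denominator
  \<open>1 - y\<close> repairs it, since the difference of the sides then has the derivative
  \<open>t\<^sup>2 / (2 * (1 - t)\<^sup>2)\<close>.\<close>

lemma ln_one_minus_ge_quadratic:
  fixes y :: real
  assumes "0 \<le> y" "y < 1"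
  shows "- y - y\<^sup>2 / (2 * (1 - y)) \<le> ln (1 - y)"
proof -
  let ?f = "\<lambda>t::real. ln (1 - t) + t + t\<^sup>2 / (2 * (1 - t))"
  have "?f 0 \<le> ?f y"
  proof (rule DERIV_nonneg_imp_nondecreasing[OF assms(1)])
    fix t :: real assume t: "0 \<le> t" "t \<le> y"
    have "(?f has_real_derivative (t\<^sup>2 / (2 * (1 - t)\<^sup>2))) (at t)"
      using t assms
      apply (auto intro!: derivative_eq_intros)
      apply (simp add: divide_simps)
      apply (simp add: algebra_simps power2_eq_square)
      done
    moreover have "0 \<le> t\<^sup>2 / (2 * (1 - t)\<^sup>2)" by simp
    ultimately show "\<exists>d. (?f has_real_derivative d) (at t) \<and> 0 \<le> d" by blast
  qed
  then show ?thesis by simp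
qed

lemma ln_one_plus_ge_fraction:
  fixes u :: real
  assumes "0 \<le> u"
  shows "u / (1 + u) \<le> ln (1 + u)"
proof -
  have "ln (1 / (1 + u)) \<le> 1 / (1 + u) - 1"
    using assms by (intro ln_le_minus_one) auto
  then show ?thesis using assms by (simp add: ln_div field_simps)
qed

text \<open>With \<open>\<rho> = G / (V + G)\<close> the number \<open>\<beta>\<close> is
  \<open>slope 1 V G\<close> for \<open>G \<ge> 0\<close>. For \<open>g \<ge> 0\<close> the
  quadratic bound and \<open>\<beta> \<le> \<rho>\<close> suffice. For \<open>g = - s < 0\<close>
  the extra denominator \<open>1 - s * \<beta>\<close> is absorbed by the square of
  \<open>1 - \<rho> / 2\<close> contained in \<open>\<beta>\<^sup>2\<close>.\<close>

lemma slope_log_bound: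
  fixes g \<rho> :: real
  assumes g: "\<bar>g\<bar> \<le> 1" and \<rho>: "0 \<le> \<rho>" "\<rho> \<le> 1"
  defines "\<beta> \<equiv> \<rho> * (1 - \<rho> / 2)"
  shows "2 * g * \<beta> - g\<^sup>2 * \<rho>\<^sup>2 \<le> 2 * ln (1 + g * \<beta>)"
proof -
  have \<beta>: "0 \<le> \<beta>" "\<beta> \<le> \<rho>"
    unfolding \<beta>_def using \<rho> by (auto simp: mult_left_le)
  have \<beta>2: "\<beta>\<^sup>2 \<le> \<rho>\<^sup>2" using \<beta> by (simp add: power_mono)
  show ?thesis
  proof (cases "0 \<le> g")
    case True
    have "g * \<beta> - (g * \<beta>)\<^sup>2 / 2 \<le> ln (1 + g * \<beta>)"
      using True \<beta> by (intro ln_one_plus_ge_quadratic) simp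
    moreover have "(g * \<beta>)\<^sup>2 \<le> g\<^sup>2 * \<rho>\<^sup>2"
      using \<beta>2 by (simp add: power_mult_distrib mult_left_mono)
    ultimately show ?thesis by simp
  next
    case False
    define s where "s = - g"
    have s: "0 \<le> s" "s \<le> 1" using False g by (auto simp: s_def)
    have half: "\<beta> \<le> 1 / 2"
    proof -
      have "1 / 2 - \<beta> = (1 - \<rho>)\<^sup>2 / 2" by (simp add: \<beta>_def power2_eq_square field_simps)
      moreover have "0 \<le> (1 - \<rho>)\<^sup>2 / 2" by simp
      ultimately show ?thesis by linarith
    qed
    have sb: "s * \<beta> \<le> \<beta>" using s \<beta> by (simp add: mult_left_le_one_le)
    have key: "(1 - \<rho> / 2)\<^sup>2 \<le> 1 - s * \<beta>"
    proof -
      have "1 - \<beta> = (1 - \<rho> / 2)\<^sup>2 + \<rho>\<^sup>2 / 4" by (simp add: \<beta>_def power2_eq_square field_simps)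
      then have "(1 - \<rho> / 2)\<^sup>2 \<le> 1 - \<beta>" by simp
      then show ?thesis using sb by linarith
    qed
    have "(s * \<beta>)\<^sup>2 = s\<^sup>2 * \<rho>\<^sup>2 * (1 - \<rho> / 2)\<^sup>2" by (simp add: \<beta>_def power_mult_distrib)
    also have "\<dots> \<le> s\<^sup>2 * \<rho>\<^sup>2 * (1 - s * \<beta>)" using key by (intro mult_left_mono) auto
    finally have "(s * \<beta>)\<^sup>2 / (1 - s * \<beta>) \<le> s\<^sup>2 * \<rho>\<^sup>2"
      using sb half by (simp add: pos_divide_le_eq)
    then have "(s * \<beta>)\<^sup>2 / (2 * (1 - s * \<beta>)) \<le> s\<^sup>2 * \<rho>\<^sup>2 / 2"
      unfolding mult.commute[of 2 "1 - _"] divide_divide_eq_left[symmetric]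
      by (rule divide_right_mono) simp
    moreover have "- (s * \<beta>) - (s * \<beta>)\<^sup>2 / (2 * (1 - s * \<beta>)) \<le> ln (1 - s * \<beta>)"
      using s \<beta> sb half by (intro ln_one_minus_ge_quadratic) auto
    ultimately have "- 2 * (s * \<beta>) - s\<^sup>2 * \<rho>\<^sup>2 \<le> 2 * ln (1 - s * \<beta>)" by linarith
    then show ?thesis by (simp add: s_def)
  qed
qed

section \<open>Change of the exponent in one round, at unit scale\<close>

text \<open>The change of the exponent equals \<open>(k + \<theta> * u) / D\<close>, where
  \<open>k\<close> is the left side of \<open>slope_log_bound\<close>, so
  \<open>(k + \<theta> * u) / D \<le> k + ln (1 + u)\<close> is enough. For \<open>g \<ge> 0\<close>
  the numerator is nonnegative and \<open>D\<close> is at least \<open>1 + \<theta> * u\<close>; for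
  \<open>g < 0\<close> the numerator is nonpositive and \<open>D \<le> 1\<close>, so dividing by
  \<open>D\<close> only helps.\<close>

lemma potential_exponent_same_sign:
  fixes g G V :: real
  assumes g: "\<bar>g\<bar> \<le> 1" and V: "0 < V" and G: "0 \<le> G" "0 \<le> G + g"
  shows "(G + g)\<^sup>2 / (V + g\<^sup>2 + (G + g)) - G\<^sup>2 / (V + G)
    \<le> ln (1 + g\<^sup>2 / V) + 2 * ln (1 + g * (G * (2 * V + G) / (2 * (V + G)\<^sup>2)))"
proof -
  define \<rho> \<theta> u D where "\<rho> = G / (V + G)" and "\<theta> = V / (V + G)" and "u = g\<^sup>2 / V"
    and "D = (V + g\<^sup>2 + (G + g)) / (V + G)"
  define \<beta> k where "\<beta> = \<rho> * (1 - \<rho> / 2)" and "k = 2 * g * \<beta> - g\<^sup>2 * \<rho>\<^sup>2"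
  have VG: "0 < V + G" using V G by simp
  have \<rho>: "0 \<le> \<rho>" "\<rho> \<le> 1" using V G VG by (auto simp: \<rho>_def field_simps)
  have \<theta>: "\<theta> = 1 - \<rho>" "0 < \<theta>" using V VG by (auto simp: \<theta>_def \<rho>_def field_simps)
  have u: "0 \<le> u" using V by (simp add: u_def)
  have A: "0 < V + g\<^sup>2 + (G + g)" using V G by (simp add: add_pos_nonneg)
  have D: "0 < D" using A VG by (simp add: D_def)
  have \<beta>_eq: "G * (2 * V + G) / (2 * (V + G)\<^sup>2) = \<beta>"
    using VG by (simp add: \<beta>_def \<rho>_def field_simps power2_eq_square)
  have k_le: "k \<le> 2 * ln (1 + g * \<beta>)"
    unfolding k_def \<beta>_def using g \<rho> by (rule slope_log_bound)
  have k_eq: "k = g * \<rho> * (2 - \<rho> - g * \<rho>)"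
    by (simp add: k_def \<beta>_def power2_eq_square algebra_simps)
  have num: "k + \<theta> * u = (2 * g * G * V + g * G\<^sup>2 - g\<^sup>2 * G\<^sup>2 + g\<^sup>2 * (V + G)) / (V + G)\<^sup>2"
    using V VG by (simp add: k_eq \<rho>_def \<theta>_def u_def divide_simps)
      (simp add: power2_eq_square algebra_simps)
  have eq: "(G + g)\<^sup>2 / (V + g\<^sup>2 + (G + g)) - G\<^sup>2 / (V + G) = (k + \<theta> * u) / D"
  proof -
    have "(k + \<theta> * u) / D = (2 * g * G * V + g * G\<^sup>2 - g\<^sup>2 * G\<^sup>2 + g\<^sup>2 * (V + G))
        / ((V + G) * (V + g\<^sup>2 + (G + g)))"
      unfolding num D_def using VG A by (simp add: divide_simps power2_eq_square)
    also have "\<dots> = ((G + g)\<^sup>2 * (V + G) - G\<^sup>2 * (V + g\<^sup>2 + (G + g)))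
        / ((V + G) * (V + g\<^sup>2 + (G + g)))"
      by (simp add: power2_eq_square algebra_simps)
    also have "\<dots> = (G + g)\<^sup>2 / (V + g\<^sup>2 + (G + g)) - G\<^sup>2 / (V + G)"
      using VG A by (simp add: diff_divide_distrib)
    finally show ?thesis by simp
  qed
  have log_u: "u / (1 + u) \<le> ln (1 + u)" using u by (rule ln_one_plus_ge_fraction)
  have D_eq: "D = 1 + (g + g\<^sup>2) / (V + G)" using VG by (simp add: D_def field_simps)
  have "(k + \<theta> * u) / D \<le> k + ln (1 + u)"
  proof (cases "0 \<le> g")
    case True
    have \<theta>u: "\<theta> * u = g\<^sup>2 / (V + G)" using V by (simp add: \<theta>_def u_def)
    have D1: "1 + \<theta> * u \<le> D" unfolding D_eq \<theta>u using True VG by (simp add: divide_right_mono)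
    have tu: "0 \<le> \<theta> * u" "\<theta> * u \<le> u" using \<theta> u \<rho> by (auto simp: mult_left_le_one_le)
    have "g * \<rho> \<le> 1" using g \<rho> True by (simp add: mult_le_one)
    then have k0: "0 \<le> k" unfolding k_eq using True \<rho> by (intro mult_nonneg_nonneg) auto
    have "(k + \<theta> * u) / D \<le> (k + \<theta> * u) / (1 + \<theta> * u)"
      using D1 tu k0 by (intro divide_left_mono) auto
    also have "\<dots> = k / (1 + \<theta> * u) + \<theta> * u / (1 + \<theta> * u)" by (rule add_divide_distrib)
    also have "k / (1 + \<theta> * u) \<le> k" using divide_left_mono[of 1 "1 + \<theta> * u" k] k0 tu by simp
    also have "\<theta> * u / (1 + \<theta> * u) \<le> u / (1 + u)" using tu u by (simp add: divide_simps algebra_simps)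
    finally show ?thesis using log_u by simp
  next
    case False
    define s where "s = - g"
    have s: "0 < s" "s \<le> 1" "s\<^sup>2 = g\<^sup>2" using False g by (auto simp: s_def)
    have D1: "D \<le> 1"
    proof -
      have "g + g\<^sup>2 = - (s * (1 - s))" by (simp add: s_def power2_eq_square algebra_simps)
      also have "\<dots> \<le> 0" using s by simp
      finally show ?thesis unfolding D_eq using VG by (simp add: divide_nonpos_pos)
    qed
    have tu: "\<theta> * u \<le> s * \<rho>"
    proof -
      have "\<theta> * u = s * (s / (V + G))" using V s by (simp add: \<theta>_def u_def power2_eq_square)
      also have "s / (V + G) \<le> \<rho>" unfolding \<rho>_def using G VG by (intro divide_right_mono) (auto simp: s_def)
      finally show ?thesis using s by simp
    qed
    have "s * \<rho> \<le> \<rho>" using s \<rho> by (simp add: mult_left_le_one_le)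
    \<comment> \<open>Here \<open>\<theta> + \<theta> * u \<le> (1 - \<rho>) + \<rho>\<close>. This
      puts \<open>\<theta> * u\<close> below \<open>u / (1 + u)\<close>, which
      \<open>ln (1 + u)\<close> dominates.\<close>
    with tu have "\<theta> * (1 + u) \<le> 1" using \<theta>(1) by (simp only: distrib_left mult_1_right)
    then have "\<theta> * u * (1 + u) \<le> u" using u by (metis mult.assoc mult.commute mult_left_le)
    then have tu': "\<theta> * u \<le> u / (1 + u)" using u by (simp add: pos_le_divide_eq add_pos_nonneg)
    have "k = - (s * \<rho> * (2 - \<rho> + s * \<rho>))" by (simp add: k_eq s_def)
    moreover have "s * \<rho> * 1 \<le> s * \<rho> * (2 - \<rho> + s * \<rho>)"
      using s \<rho> by (intro mult_left_mono) (auto simp: add_increasing2)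
    ultimately have nonpos: "k + \<theta> * u \<le> 0" using tu by simp
    then have "(k + \<theta> * u) * 1 \<le> (k + \<theta> * u) * D"
      using D1 by (intro mult_left_mono_neg)
    then have "(k + \<theta> * u) / D \<le> k + \<theta> * u" using D by (simp add: pos_divide_le_eq)
    then show ?thesis using tu' log_u by linarith
  qed
  then show ?thesis unfolding eq \<beta>_eq using k_le by (simp add: u_def)
qed

text \<open>The certificate is that every coefficient of the difference of the two sides, expanded in
  \<open>V\<close>, \<open>G\<close>, \<open>z\<close>, is nonnegative.\<close>

lemma opposite_sign_polynomial:
  fixes V G z :: real
  assumes "0 \<le> V" "0 \<le> G" "0 \<le> z"
  defines "s \<equiv> G + z"
  defines "W \<equiv> V + s * G"
  defines "A \<equiv> V + s\<^sup>2 + s * z"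
  shows "4 * V * W ^ 5 * A \<le> (V + s\<^sup>2) * (W\<^sup>2 + V\<^sup>2)\<^sup>2 * (A * W - z\<^sup>2 * W + G\<^sup>2 * A)"
  unfolding A_def W_def s_def using assms(1-3)
  by (simp add: algebra_simps eval_nat_numeral) (intro add_nonneg_nonneg mult_nonneg_nonneg; simp)

text \<open>The polynomial inequality gives the bound with \<open>w0 = 1 / (V + s * G)\<close> in place of \<open>w = 1 / (V + G)\<close>;
  the expression \<open>(X v)\<^sup>2 * Y v\<close> only increases when \<open>v\<close> drops from \<open>w0\<close> to \<open>w\<close>.\<close>

lemma potential_exponent_opposite_sign:
  fixes s G V :: real
  assumes V: "0 < V" and G: "0 \<le> G" "G \<le> s" and s: "s \<le> 1"
  shows "(s - G)\<^sup>2 / (V + s\<^sup>2 + (s - G)) - G\<^sup>2 / (V + G)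
    \<le> ln (1 + s\<^sup>2 / V) + 2 * ln (1 - s * (G * (2 * V + G) / (2 * (V + G)\<^sup>2)))"
proof -
  define z where "z = s - G"
  define W w w0 A where "W = V + s * G" and "w = 1 / (V + G)" and "w0 = 1 / W"
    and "A = V + s\<^sup>2 + s * z"
  define K where "K = 1 - z\<^sup>2 / A"
  \<comment> \<open>At \<open>v = w\<close>, \<open>X v / 2\<close> is the argument of the second
    logarithm, and \<open>Y v - 1\<close> is at most minus the change of the exponent, because
    \<open>s \<le> 1\<close> gives \<open>A \<le> V + s\<^sup>2 + z\<close>. By
    \<open>ln y \<le> y - 1\<close> it remains to prove
    \<open>1 \<le> (1 + s\<^sup>2 / V) * (X w / 2)\<^sup>2 * Y w\<close>.\<close>
  define X Y where "X v = 2 - s * G * (v + V * v\<^sup>2)" and "Y v = K + G\<^sup>2 * v" for v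
  have z: "0 \<le> z" "s = G + z" and s0: "0 \<le> s" using G by (auto simp: z_def)
  have W: "0 < W" using V G s0 by (simp add: W_def add_pos_nonneg)
  have A: "0 < A" using V z s0 by (simp add: A_def add_pos_nonneg)
  have VG: "0 < V + G" using V G by simp
  have w: "0 < w" using VG by (simp add: w_def)
  have w_le: "w \<le> w0"
    unfolding w_def w0_def W_def using V G s s0 W
    by (intro divide_left_mono) (auto simp: mult_left_le_one_le W_def intro!: mult_pos_pos)
  have X0: "X w0 = (W\<^sup>2 + V\<^sup>2) / W\<^sup>2"
  proof -
    have sG: "s * G = W - V" by (simp add: W_def)
    show ?thesis unfolding X_def w0_def sG using W by (simp add: field_simps power2_eq_square)
  qed
  have "0 < X w0" using X0 W V by (simp add: add_pos_nonneg)
  moreover have "X w0 \<le> 2" using s0 G w w_le V by (simp add: X_def)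
  ultimately have X0_bounds: "0 < X w0" "X w0 \<le> 2" by auto
  have Y0: "Y w0 = (A * W - z\<^sup>2 * W + G\<^sup>2 * A) / (A * W)"
    using A W by (simp add: Y_def K_def w0_def field_simps)
  have "4 * V * W ^ 5 * A \<le> (V + s\<^sup>2) * (W\<^sup>2 + V\<^sup>2)\<^sup>2 * (A * W - z\<^sup>2 * W + G\<^sup>2 * A)"
    using opposite_sign_polynomial[of V G z] V G z by (simp add: W_def A_def)
  moreover have "(V + s\<^sup>2) * (X w0)\<^sup>2 * Y w0
      = (V + s\<^sup>2) * (W\<^sup>2 + V\<^sup>2)\<^sup>2 * (A * W - z\<^sup>2 * W + G\<^sup>2 * A) / (W ^ 5 * A)"
    unfolding X0 Y0 by (simp add: power_divide eval_nat_numeral)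
  ultimately have base: "4 * V \<le> (V + s\<^sup>2) * (X w0)\<^sup>2 * Y w0"
    using W A by (simp add: pos_le_divide_eq mult.assoc)
  have sK: "G \<le> s * K"
  proof -
    have "G * A \<le> s * (A - z\<^sup>2)"
    proof -
      have "s * (A - z\<^sup>2) - G * A = z * V + s\<^sup>2 * z"
        by (simp add: A_def z(2) power2_eq_square algebra_simps)
      moreover have "0 \<le> z * V + s\<^sup>2 * z" using z V by simp
      ultimately show ?thesis by linarith
    qed
    then show ?thesis using A by (simp add: K_def field_simps)
  qed
  have K: "0 \<le> K"
  proof -
    have "z\<^sup>2 \<le> s\<^sup>2" using z G by (intro power_mono) auto
    then have "z\<^sup>2 \<le> A" using V z s0 by (simp add: A_def add_increasing2 add_increasing)
    then show ?thesis using A by (simp add: K_def)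
  qed
  then have Ypos: "0 \<le> Y w" using w by (simp add: Y_def)
  define d where "d = w0 - w"
  have d: "0 \<le> d" using w_le by (simp add: d_def)
  have XX: "X w0 + s * G * d \<le> X w"
  proof -
    have "X w - X w0 - s * G * d = s * G * V * (w0\<^sup>2 - w\<^sup>2)"
      by (simp add: X_def d_def algebra_simps)
    moreover have "0 \<le> s * G * V * (w0\<^sup>2 - w\<^sup>2)"
      using w w_le s0 G V by (intro mult_nonneg_nonneg) (auto simp: power_mono)
    ultimately show ?thesis by linarith
  qed
  have sGd: "0 \<le> s * G * d" using s0 G d by simp
  have Xw: "0 < X w" using XX sGd X0_bounds by linarith
  \<comment> \<open>When \<open>v\<close> drops by \<open>d\<close>, \<open>Y\<close> loses
    \<open>G\<^sup>2 * d\<close>, while \<open>X\<^sup>2\<close> gains at least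
    \<open>2 * X w0 * (s * G * d)\<close>. The gain wins because \<open>sK\<close> gives
    \<open>G \<le> s * Y w\<close> and \<open>X w0 \<le> 2\<close>.\<close>
  have mono: "(X w0)\<^sup>2 * Y w0 \<le> (X w)\<^sup>2 * Y w"
  proof -
    have Yw: "G \<le> s * Y w" using sK s0 w by (simp add: Y_def algebra_simps add_increasing2)
    have "(X w0 + s * G * d)\<^sup>2 \<le> (X w)\<^sup>2" using XX X0_bounds sGd by (intro power_mono) auto
    moreover have "(X w0)\<^sup>2 + 2 * X w0 * (s * G * d) \<le> (X w0 + s * G * d)\<^sup>2"
      by (simp add: power2_sum)
    ultimately have "((X w0)\<^sup>2 + 2 * X w0 * (s * G * d)) * Y w \<le> (X w)\<^sup>2 * Y w"
      using Ypos by (intro mult_right_mono) auto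
    moreover have "((X w0)\<^sup>2 + 2 * X w0 * (s * G * d)) * Y w - (X w0)\<^sup>2 * Y w0
        = X w0 * G * d * (2 * (s * Y w) - X w0 * G)"
      by (simp add: Y_def d_def power2_eq_square algebra_simps)
    moreover have "0 \<le> X w0 * G * d * (2 * (s * Y w) - X w0 * G)"
    proof -
      have "X w0 * G \<le> 2 * G" using X0_bounds G by (intro mult_right_mono)
      then show ?thesis using Yw X0_bounds G d by simp
    qed
    ultimately show ?thesis by linarith
  qed
  have "4 * V \<le> (V + s\<^sup>2) * ((X w)\<^sup>2 * Y w)"
    using base mult_left_mono[OF mono, of "V + s\<^sup>2"] V by (simp add: mult.assoc)
  then have prod: "1 \<le> (1 + s\<^sup>2 / V) * (X w / 2)\<^sup>2 * Y w"
    using V by (simp add: field_simps)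
  have Yw: "0 < Y w"
    using prod V by (smt (verit) divide_nonneg_pos mult_nonneg_nonpos zero_le_mult_iff zero_le_power2)
  have "0 \<le> ln ((1 + s\<^sup>2 / V) * (X w / 2)\<^sup>2 * Y w)" using prod by simp
  also have "\<dots> = ln (1 + s\<^sup>2 / V) + 2 * ln (X w / 2) + ln (Y w)"
    using V Xw Yw by (simp add: ln_mult_pos ln_realpow add_pos_nonneg)
  also have "ln (Y w) \<le> Y w - 1" using Yw by (rule ln_le_minus_one)
  also have "Y w - 1 \<le> - (z\<^sup>2 / (V + s\<^sup>2 + z) - G\<^sup>2 / (V + G))"
  proof -
    have "z\<^sup>2 / (V + s\<^sup>2 + z) \<le> z\<^sup>2 / A"
      unfolding A_def using V z s s0 A
      by (intro divide_left_mono) (auto simp: mult_left_le_one_le A_def intro!: mult_pos_pos add_pos_nonneg)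
    then show ?thesis by (simp add: Y_def K_def w_def)
  qed
  finally have "z\<^sup>2 / (V + s\<^sup>2 + z) - G\<^sup>2 / (V + G) \<le> ln (1 + s\<^sup>2 / V) + 2 * ln (X w / 2)" by simp
  moreover have "X w / 2 = 1 - s * (G * (2 * V + G) / (2 * (V + G)\<^sup>2))"
    using VG by (simp add: X_def w_def divide_simps) (simp add: power2_eq_square algebra_simps)
  ultimately show ?thesis by (simp add: z_def)
qed

section \<open>The potential and its one-round decrease\<close>

text \<open>The factor \<open>h\<^sub>\<tau>\<^sup>2\<close>, constant in an epoch, is left out.
  What remains is homogeneous of degree -1 when \<open>h\<close>, \<open>V\<close>, \<open>G\<close>
  are scaled with weights 1, 2, 1.\<close>

definition potential :: "real \<Rightarrow> real \<Rightarrow> real \<Rightarrow> real" where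
  "potential h V G = exp (G\<^sup>2 / (2 * V + 2 * h * \<bar>G\<bar>)) / sqrt V"

text \<open>The logarithmic derivative of the potential in \<open>G\<close>.\<close>

definition slope :: "real \<Rightarrow> real \<Rightarrow> real \<Rightarrow> real" where
  "slope h V G = G * (2 * V + h * \<bar>G\<bar>) / (2 * (V + h * \<bar>G\<bar>)\<^sup>2)"

text \<open>Keeps \<open>1 + g * slope 1 V G\<close> positive for
  \<open>\<bar>g\<bar> \<le> 1\<close>, so that exponentiating its logarithm gives it back.\<close>

lemma abs_slope_le_half:
  assumes "0 < V"
  shows "\<bar>slope 1 V G\<bar> \<le> 1 / 2"
proof -
  define a where "a = \<bar>G\<bar>"
  have a: "0 \<le> a" "0 < V + a" using assms by (auto simp: a_def)
  have "a * (2 * V + a) / (2 * (V + a)\<^sup>2) \<le> 1 / 2"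
    using a assms by (simp add: divide_simps) (simp add: power2_eq_square algebra_simps)
  moreover have "\<bar>slope 1 V G\<bar> = a * (2 * V + a) / (2 * (V + a)\<^sup>2)"
    using a assms by (simp add: slope_def abs_mult a_def)
  ultimately show ?thesis by simp
qed

text \<open>Reflecting both \<open>G\<close> and \<open>g\<close> reduces to
  \<open>G \<ge> 0\<close>; the sign of \<open>G + g\<close> then selects the exponent inequality.
  Half of that inequality is exponentiated, and half of \<open>ln (1 + g\<^sup>2 / V)\<close>
  becomes the quotient of the two square roots in the potential.\<close>

lemma potential_step_unit:
  fixes g G V :: real
  assumes g: "\<bar>g\<bar> \<le> 1" and V: "0 < V"
  shows "potential 1 (V + g\<^sup>2) (G + g) \<le> potential 1 V G * (1 + g * slope 1 V G)"
proof -
  have nonneg: "(G' + g')\<^sup>2 / (V + g'\<^sup>2 + \<bar>G' + g'\<bar>) - G'\<^sup>2 / (V + \<bar>G'\<bar>)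
      \<le> ln (1 + g'\<^sup>2 / V) + 2 * ln (1 + g' * slope 1 V G')"
    if "0 \<le> G'" "\<bar>g'\<bar> \<le> 1" for G' g' :: real
  proof (cases "0 \<le> G' + g'")
    case True
    then show ?thesis using potential_exponent_same_sign[of g' V G'] that V by (simp add: slope_def)
  next
    case False
    have abs: "- g' - G' = \<bar>G' + g'\<bar>" using False by simp
    have "- g' \<le> 1" "G' \<le> - g'" using that False by auto
    from potential_exponent_opposite_sign[OF V that(1) this(2,1), unfolded abs power2_abs]
    show ?thesis using that by (simp add: slope_def)
  qed
  have exponent: "(G + g)\<^sup>2 / (V + g\<^sup>2 + \<bar>G + g\<bar>) - G\<^sup>2 / (V + \<bar>G\<bar>)
      \<le> ln (1 + g\<^sup>2 / V) + 2 * ln (1 + g * slope 1 V G)"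
  proof (cases "0 \<le> G")
    case True
    then show ?thesis using nonneg g by blast
  next
    case False
    have "(- G + - g)\<^sup>2 = (G + g)\<^sup>2" "\<bar>- G + - g\<bar> = \<bar>G + g\<bar>"
      by (auto simp: power2_eq_square algebra_simps)
    moreover have "- g * slope 1 V (- G) = g * slope 1 V G" by (simp add: slope_def)
    ultimately show ?thesis using nonneg[of "- G" "- g"] False g by simp
  qed
  have "\<bar>g * slope 1 V G\<bar> \<le> 1 * (1 / 2)"
    unfolding abs_mult using g abs_slope_le_half[OF V] by (intro mult_mono) auto
  then have factor: "0 < 1 + g * slope 1 V G" by linarith
  have ratio: "0 < 1 + g\<^sup>2 / V" using V by (simp add: add_pos_nonneg)
  have half: "H\<^sup>2 / (2 * U + 2 * \<bar>H\<bar>) = H\<^sup>2 / (U + \<bar>H\<bar>) / 2" for H U :: real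
    by (simp add: field_simps)
  have halve: "a / 2 \<le> b / 2 + c / 2 + d" if "a - b \<le> c + 2 * d" for a b c d :: real
    using that by linarith
  have "(G + g)\<^sup>2 / (2 * (V + g\<^sup>2) + 2 * \<bar>G + g\<bar>)
      \<le> G\<^sup>2 / (2 * V + 2 * \<bar>G\<bar>) + ln (1 + g\<^sup>2 / V) / 2 + ln (1 + g * slope 1 V G)"
    unfolding half using halve[OF exponent] .
  then have "exp ((G + g)\<^sup>2 / (2 * (V + g\<^sup>2) + 2 * \<bar>G + g\<bar>))
      \<le> exp (G\<^sup>2 / (2 * V + 2 * \<bar>G\<bar>) + ln (1 + g\<^sup>2 / V) / 2 + ln (1 + g * slope 1 V G))"
    by (simp only: exp_le_cancel_iff)
  also have "\<dots> = exp (G\<^sup>2 / (2 * V + 2 * \<bar>G\<bar>)) * exp (ln (sqrt (1 + g\<^sup>2 / V)))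
      * exp (ln (1 + g * slope 1 V G))"
    using ratio by (simp only: exp_add ln_sqrt)
  also have "\<dots> = exp (G\<^sup>2 / (2 * V + 2 * \<bar>G\<bar>)) * sqrt (1 + g\<^sup>2 / V) * (1 + g * slope 1 V G)"
    using ratio factor by simp
  also have "1 + g\<^sup>2 / V = (V + g\<^sup>2) / V" using V by (simp add: add_divide_distrib)
  also have "sqrt ((V + g\<^sup>2) / V) = sqrt (V + g\<^sup>2) / sqrt V" by (rule real_sqrt_divide)
  finally have "exp ((G + g)\<^sup>2 / (2 * (V + g\<^sup>2) + 2 * \<bar>G + g\<bar>))
      \<le> exp (G\<^sup>2 / (2 * V + 2 * \<bar>G\<bar>)) * (sqrt (V + g\<^sup>2) / sqrt V) * (1 + g * slope 1 V G)" .
  moreover have "0 < sqrt (V + g\<^sup>2)" using V by (simp add: add_pos_nonneg)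
  ultimately show ?thesis using V by (simp add: potential_def field_simps)
qed

lemma potential_rescale:
  assumes "0 < h" 
  shows "potential h V G = potential 1 (V / h\<^sup>2) (G / h) / h"
proof -
  have "(G / h)\<^sup>2 / (2 * (V / h\<^sup>2) + 2 * 1 * \<bar>G / h\<bar>) = G\<^sup>2 / (2 * V + 2 * h * \<bar>G\<bar>)"
  proof -
    have "2 * (V / h\<^sup>2) + 2 * 1 * \<bar>G / h\<bar> = (2 * V + 2 * h * \<bar>G\<bar>) / h\<^sup>2"
      using assms by (simp add: field_simps power2_eq_square)
    then show ?thesis using assms by (simp add: power_divide)
  qed
  moreover have "sqrt (V / h\<^sup>2) = sqrt V / h" using assms by (simp add: real_sqrt_divide)
  ultimately show ?thesis using assms by (simp add: potential_def)
qed

lemma slope_rescale: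
  assumes "0 < h"
  shows "slope h V G = slope 1 (V / h\<^sup>2) (G / h) / h"
proof -
  have 1: "2 * (V / h\<^sup>2) + 1 * \<bar>G / h\<bar> = (2 * V + h * \<bar>G\<bar>) / h\<^sup>2"
    and 2: "V / h\<^sup>2 + 1 * \<bar>G / h\<bar> = (V + h * \<bar>G\<bar>) / h\<^sup>2"
    using assms by (simp_all add: field_simps power2_eq_square)
  show ?thesis unfolding slope_def 1 2 using assms
    by (simp add: power_divide) (simp add: eval_nat_numeral)
qed

lemma potential_step:
  assumes g: "\<bar>g\<bar> \<le> h" and h: "0 < h" and V: "0 < V"
  shows "potential h (V + g\<^sup>2) (G + g) \<le> potential h V G * (1 + g * slope h V G)"
proof -
  have "potential 1 (V / h\<^sup>2 + (g / h)\<^sup>2) (G / h + g / h)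
      \<le> potential 1 (V / h\<^sup>2) (G / h) * (1 + (g / h) * slope 1 (V / h\<^sup>2) (G / h))"
    using g h V by (intro potential_step_unit) (auto simp: abs_if field_simps)
  then show ?thesis
    using h by (simp add: potential_rescale[OF h] slope_rescale[OF h] divide_right_mono
        power_divide add_divide_distrib)
qed

text \<open>The scale may grow between rounds of an epoch. By this monotonicity the potential of the
  previous rounds may be re-evaluated at a larger scale.\<close>

lemma potential_antimono_scale:
  assumes "h \<le> h'" "0 < h" "0 < V"
  shows "potential h' V G \<le> potential h V G"
proof -
  have "h * \<bar>G\<bar> \<le> h' * \<bar>G\<bar>" using assms by (simp add: mult_right_mono)
  then have "G\<^sup>2 / (2 * V + 2 * h' * \<bar>G\<bar>) \<le> G\<^sup>2 / (2 * V + 2 * h * \<bar>G\<bar>)"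
    using assms by (intro divide_left_mono) (auto intro!: mult_pos_pos add_pos_nonneg)
  then show ?thesis using assms by (simp add: potential_def divide_right_mono)
qed

section \<open>The comparator against the potential\<close>

text \<open>\<open>L\<close> is a threshold for the exponent. Above it the potential term outweighs
  \<open>\<bar>w\<bar> * \<bar>G\<bar>\<close> by assumption; below it \<open>\<bar>G\<bar>\<close>
  satisfies a quadratic inequality, whose solution is at most
  \<open>2 * h * L + sqrt (2 * V * L)\<close>.\<close>

lemma comparator_minus_potential_le:
  fixes w G V h a L :: real
  assumes V: "0 < V" and h: "0 < h" and a: "0 < a" and L: "0 \<le> L"
    and m: "\<bar>w\<bar> * \<bar>G\<bar> \<le> a * exp L"
  shows "\<bar>w\<bar> * \<bar>G\<bar> - a * exp (G\<^sup>2 / (2 * V + 2 * h * \<bar>G\<bar>)) \<le> \<bar>w\<bar> * (2 * h * L + sqrt (2 * V * L))"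
proof (cases "L \<le> G\<^sup>2 / (2 * V + 2 * h * \<bar>G\<bar>)")
  case True
  then have "a * exp L \<le> a * exp (G\<^sup>2 / (2 * V + 2 * h * \<bar>G\<bar>))" using a by simp
  with m have "\<bar>w\<bar> * \<bar>G\<bar> - a * exp (G\<^sup>2 / (2 * V + 2 * h * \<bar>G\<bar>)) \<le> 0" by linarith
  also have "0 \<le> \<bar>w\<bar> * (2 * h * L + sqrt (2 * V * L))" using V h L by simp
  finally show ?thesis .
next
  case False
  define r where "r = sqrt (2 * V * L)"
  have r: "0 \<le> r" "r\<^sup>2 = 2 * V * L" using V L by (auto simp: r_def)
  have "0 < 2 * V + 2 * h * \<bar>G\<bar>" using V h by (simp add: add_pos_nonneg)
  with False have G2: "\<bar>G\<bar>\<^sup>2 < r\<^sup>2 + 2 * h * L * \<bar>G\<bar>"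
    by (simp add: r pos_divide_less_eq algebra_simps not_le)
  have "\<bar>G\<bar> \<le> 2 * h * L + r"
  proof (rule ccontr)
    assume "\<not> ?thesis"
    then have *: "2 * h * L + r < \<bar>G\<bar>" by simp
    have hL: "0 \<le> 2 * h * L" using h L by simp
    have "r\<^sup>2 + 2 * h * L * \<bar>G\<bar> \<le> r * \<bar>G\<bar> + 2 * h * L * \<bar>G\<bar>"
      unfolding power2_eq_square using * hL r by (intro add_right_mono mult_left_mono) linarith+
    also have "\<dots> = (2 * h * L + r) * \<bar>G\<bar>" by (simp add: algebra_simps)
    also have "\<dots> \<le> \<bar>G\<bar> * \<bar>G\<bar>" using * by (intro mult_right_mono) auto
    finally show False using G2 by (simp add: power2_eq_square)
  qed
  then have "\<bar>w\<bar> * \<bar>G\<bar> \<le> \<bar>w\<bar> * (2 * h * L + r)" by (intro mult_left_mono) auto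
  moreover have "0 \<le> a * exp (G\<^sup>2 / (2 * V + 2 * h * \<bar>G\<bar>))" using a by simp
  ultimately show ?thesis by (simp add: r_def)
qed

text \<open>Stated for one epoch: \<open>\<eta>\<close> and \<open>b\<close> are the values of
  \<open>hmax\<close> and \<open>B_sum\<close> at its start, \<open>S\<close> its sum of squared
  gradients, and \<open>Q\<close> stands for \<open>V_sum\<close>. The threshold is the logarithm of
  \<open>P = 2 * \<bar>w\<bar>\<^sup>2 * Q * c\<close>.\<close>

lemma comparator_cost_le:
  fixes w G S h \<eta> b B C Q :: real
  assumes \<eta>: "0 < \<eta>" "\<eta> \<le> h" and S: "0 \<le> S" "S \<le> Q" and b: "0 < b" "b \<le> B" and B: "1 \<le> B"
    and G: "G\<^sup>2 \<le> C * S" "G\<^sup>2 \<le> \<eta>\<^sup>2 * B * C"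
  defines "c \<equiv> 2 * B\<^sup>2 * C"
  shows "\<bar>w\<bar> * \<bar>G\<bar> - \<eta> / (b * sqrt (\<eta>\<^sup>2 + S)) * exp (G\<^sup>2 / (2 * (\<eta>\<^sup>2 + S) + 2 * h * \<bar>G\<bar>))
    \<le> 1 / 2 + \<bar>w\<bar> * (7 * h * ln_plus (2 * \<bar>w\<bar> * sqrt (2 * Q * c))
        + sqrt (2 * S * ln_plus (2 * \<bar>w\<bar>\<^sup>2 * Q * c)))"
    (is "_ - ?a * ?e \<le> 1 / 2 + \<bar>w\<bar> * (7 * h * ?Y + sqrt (2 * S * ?Z))")
proof -
  have V: "0 < \<eta>\<^sup>2 + S" and h: "0 < h" using \<eta> S by (auto simp: add_pos_nonneg)
  have a: "0 < ?a" using \<eta> V b by simp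
  have YZ: "0 \<le> ?Y" "0 \<le> ?Z" by (simp_all add: ln_plus_def)
  have "0 \<le> \<eta>\<^sup>2 * B * C" using G(2) by (meson order_trans zero_le_power2)
  moreover have "0 < \<eta>\<^sup>2 * B" using \<eta> B by simp
  ultimately have C: "0 \<le> C" using mult_le_cancel_left_pos[of "\<eta>\<^sup>2 * B" 0 C] by simp
  show ?thesis
  proof (cases "\<bar>w\<bar> * \<bar>G\<bar> \<le> 1 / 2")
    case True
    moreover have "0 \<le> \<bar>w\<bar> * (7 * h * ?Y + sqrt (2 * S * ?Z))" using h YZ S by simp
    moreover have "0 \<le> ?a * ?e" by (intro mult_nonneg_nonneg less_imp_le[OF a]) simp
    ultimately show ?thesis by linarith
  next
    case False
    define m where "m = \<bar>w\<bar> * \<bar>G\<bar>"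
    define P where "P = 2 * \<bar>w\<bar>\<^sup>2 * Q * c"
    have m: "1 < 2 * m" using False by (simp add: m_def)
    have m2: "m\<^sup>2 = \<bar>w\<bar>\<^sup>2 * G\<^sup>2" by (simp add: m_def power_mult_distrib)
    have B2: "1 \<le> B\<^sup>2" using B by (rule one_le_power)
    have CS: "C * S \<le> C * Q" using S C by (intro mult_left_mono)
    have P_eq: "P = 4 * (\<bar>w\<bar>\<^sup>2 * (B\<^sup>2 * (C * Q)))" by (simp add: P_def c_def)
    have P1: "1 < P"
    proof -
      have "1 < (2 * m)\<^sup>2" using m by (intro one_less_power) auto
      also have "\<dots> = 4 * (\<bar>w\<bar>\<^sup>2 * (1 * G\<^sup>2))" by (simp add: power_mult_distrib m2)
      also have "\<dots> \<le> P"
        unfolding P_eq using B2 G(1) CS by (intro mult_left_mono mult_mono) auto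
      finally show ?thesis .
    qed
    define L where "L = ln P"
    have L: "0 < L" "exp L = P" using P1 by (auto simp: L_def)
    have Z: "?Z = L" unfolding P_def[symmetric] ln_plus_def using L P1 by (simp add: L_def)
    \<comment> \<open>\<open>?Y\<close> is the logarithm of \<open>sqrt (4 * P)\<close>, hence
      \<open>(ln 4 + L) / 2\<close>, and \<open>ln 4 \<ge> 3 / 4\<close>. The constant will pay for
      the \<open>1 / 2\<close> in \<open>sqrt (2 * L) \<le> L + 1 / 2\<close>.\<close>
    have Y: "L / 2 + 3 / 8 \<le> ?Y"
    proof -
      have "2 * \<bar>w\<bar> * sqrt (2 * Q * c) = sqrt (4 * P)"
      proof -
        have "4 * P = (2 * \<bar>w\<bar>)\<^sup>2 * (2 * Q * c)" by (simp add: P_def power_mult_distrib)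
        then show ?thesis by (simp only: real_sqrt_mult real_sqrt_abs abs_mult abs_idempotent abs_numeral)
      qed
      moreover have "ln (sqrt (4 * P)) = (ln 4 + L) / 2"
        using P1 by (simp add: ln_sqrt ln_mult_pos L_def)
      moreover have "ln (1 / 4) \<le> 1 / 4 - (1::real)" by (rule ln_le_minus_one) simp
      ultimately show ?thesis using P1 by (simp add: ln_plus_def ln_div)
    qed
    \<comment> \<open>Bounds the part of \<open>G\<^sup>2 * sqrt (\<eta>\<^sup>2 + S)\<close> due to
      \<open>sqrt S\<close> with a single factor \<open>\<eta>\<close>. The second bound on
      \<open>G\<^sup>2\<close> serves when \<open>\<eta> \<le> sqrt S\<close>, the first one
      otherwise.\<close>
    have growth: "G\<^sup>2 * sqrt S \<le> \<eta> * (B * (C * S))"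
    proof (cases "\<eta> \<le> sqrt S")
      case True
      have "G\<^sup>2 * sqrt S \<le> \<eta>\<^sup>2 * B * C * sqrt S" using G(2) S by (intro mult_right_mono) auto
      also have "\<dots> = \<eta> * (B * (C * (\<eta> * sqrt S)))" by (simp add: power2_eq_square)
      also have "\<dots> \<le> \<eta> * (B * (C * (sqrt S * sqrt S)))"
        using True \<eta> B C S by (intro mult_left_mono mult_right_mono) auto
      finally show ?thesis using S by simp
    next
      case False
      have "G\<^sup>2 * sqrt S \<le> 1 * (C * S) * \<eta>" using G(1) False S C by (intro mult_mono) auto
      also have "\<dots> \<le> B * (C * S) * \<eta>" using B C S \<eta> by (intro mult_right_mono) auto
      finally show ?thesis by (simp add: mult_ac)
    qed
    have "m \<le> ?a * exp L"
    proof -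
      have "m \<le> 2 * m\<^sup>2" using m mult_right_mono[of 1 "2 * m" m] by (simp add: power2_eq_square)
      have root: "sqrt (\<eta>\<^sup>2 + S) \<le> \<eta> + sqrt S"
        using sqrt_add_le_add_sqrt[of "\<eta>\<^sup>2" S] \<eta> S by simp
      have "m * (b * sqrt (\<eta>\<^sup>2 + S)) \<le> 2 * m\<^sup>2 * (B * (\<eta> + sqrt S))"
        using \<open>m \<le> 2 * m\<^sup>2\<close> root b m B V by (intro mult_mono) auto
      also have "\<dots> = 2 * \<bar>w\<bar>\<^sup>2 * B * (\<eta> * G\<^sup>2 + G\<^sup>2 * sqrt S)"
        by (simp add: m2 algebra_simps)
      also have "\<dots> \<le> 2 * \<bar>w\<bar>\<^sup>2 * B * (\<eta> * (B * (C * Q)) + \<eta> * (B * (C * Q)))"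
      proof -
        have "1 * (C * S) \<le> B * (C * Q)" using B C S CS by (intro mult_mono) auto
        then have "\<eta> * G\<^sup>2 \<le> \<eta> * (B * (C * Q))" using G(1) \<eta> by (intro mult_left_mono) auto
        moreover have "\<eta> * (B * (C * S)) \<le> \<eta> * (B * (C * Q))"
          using S C \<eta> B by (intro mult_left_mono) auto
        ultimately have "\<eta> * G\<^sup>2 + G\<^sup>2 * sqrt S \<le> \<eta> * (B * (C * Q)) + \<eta> * (B * (C * Q))"
          using growth by linarith
        then show ?thesis by (rule mult_left_mono) (use B in simp)
      qed
      also have "\<dots> = \<eta> * P" by (simp add: P_eq power2_eq_square)
      finally show ?thesis using V b by (simp add: L pos_le_divide_eq)
    qed
    then have "m - ?a * ?e \<le> \<bar>w\<bar> * (2 * h * L + sqrt (2 * (\<eta>\<^sup>2 + S) * L))"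
      unfolding m_def using V h a L by (intro comparator_minus_potential_le) auto
    also have "\<dots> \<le> \<bar>w\<bar> * (7 * h * ?Y + sqrt (2 * S * ?Z))"
    proof (rule mult_left_mono)
      \<comment> \<open>The initial value \<open>\<eta>\<^sup>2\<close> is split off the root and
        charged to the term linear in \<open>h\<close>, so that only \<open>S\<close> stays under
        the root.\<close>
      have "sqrt (2 * (\<eta>\<^sup>2 + S) * L) \<le> \<eta> * sqrt (2 * L) + sqrt (2 * S * L)"
        using sqrt_add_le_add_sqrt[of "\<eta>\<^sup>2 * (2 * L)" "2 * S * L"] \<eta> S L
        by (simp add: real_sqrt_mult algebra_simps)
      also have "\<eta> * sqrt (2 * L) \<le> h * (L + 1 / 2)"
      proof (rule mult_mono)
        show "sqrt (2 * L) \<le> L + 1 / 2"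
          using arith_geo_mean_sqrt[of "2 * L" 1] L by simp
      qed (use \<eta> L in auto)
      finally have "2 * h * L + sqrt (2 * (\<eta>\<^sup>2 + S) * L) \<le> h * (3 * L + 1 / 2) + sqrt (2 * S * L)"
        by (simp add: algebra_simps)
      also have "h * (3 * L + 1 / 2) \<le> h * (7 * ?Y)" using Y L h by (intro mult_left_mono) auto
      finally show "2 * h * L + sqrt (2 * (\<eta>\<^sup>2 + S) * L) \<le> 7 * h * ?Y + sqrt (2 * S * ?Z)"
        unfolding Z by (simp only: mult_ac)
    qed simp
    finally show ?thesis by (simp add: m_def)
  qed
qed

section \<open>Scales and restarts\<close>

lemma B_sum_Suc: "B_sum x (Suc n) = B_sum x n + \<bar>x (Suc n)\<bar> / hmax x (Suc n)"
  by (simp add: B_sum_def)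

lemma abs_le_hmax: "1 \<le> s \<Longrightarrow> s \<le> t \<Longrightarrow> \<bar>x s\<bar> \<le> hmax x t"
  by (auto simp: hmax_def intro!: Max_ge)

lemma hmax_mono: "1 \<le> s \<Longrightarrow> s \<le> t \<Longrightarrow> hmax x s \<le> hmax x t"
  unfolding hmax_def by (intro Max_mono) auto

lemma hmax_Suc:
  assumes "1 \<le> n"
  shows "hmax x (Suc n) = max \<bar>x (Suc n)\<bar> (hmax x n)"
proof -
  have "{1..Suc n} = insert (Suc n) {1..n}" by auto
  then show ?thesis using assms by (simp add: hmax_def)
qed

lemma restart_bounds:
  assumes "1 \<le> t"
  shows "1 \<le> restart x t \<and> restart x t \<le> t"
  using assms
proof (induction t)
  case (Suc n)
  then show ?case by (cases "n = 0") auto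
qed simp

lemma restart_eq_between:
  "restart x t \<le> s \<Longrightarrow> s \<le> t \<Longrightarrow> restart x s = restart x t"
proof (induction t)
  case (Suc n)
  then show ?case by (cases "s = Suc n") (auto split: if_splits)
qed simp

locale rounds =
  fixes x :: "nat \<Rightarrow> real"
  assumes first_nonzero: "0 < \<bar>x 1\<bar>"
begin

lemma hmax_pos: "1 \<le> t \<Longrightarrow> 0 < hmax x t"
  using first_nonzero abs_le_hmax[of 1 t x] by linarith

lemma ratio_bounds:
  assumes "1 \<le> t"
  shows "0 \<le> \<bar>x t\<bar> / hmax x t" "\<bar>x t\<bar> / hmax x t \<le> 1"
  using hmax_pos[OF assms] abs_le_hmax[OF assms order_refl, of x] by auto

lemma B_sum_mono: "s \<le> t \<Longrightarrow> B_sum x s \<le> B_sum x t"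
  unfolding B_sum_def using ratio_bounds by (intro sum_mono2) auto

lemma B_sum_one: "B_sum x 1 = 1"
  using first_nonzero by (simp add: B_sum_def hmax_def)

lemma B_sum_ge_one: "1 \<le> t \<Longrightarrow> 1 \<le> B_sum x t"
  using B_sum_mono[of 1 t] B_sum_one by simp

lemma B_sum_le: "B_sum x t \<le> real t"
proof -
  have "B_sum x t \<le> (\<Sum>s = 1..t. 1)"
    unfolding B_sum_def using ratio_bounds by (intro sum_mono) auto
  then show ?thesis by simp
qed

text \<open>In a round without restart, a new maximum raises \<open>B_sum\<close> by exactly one,
  and the failed test is then the claim; without a new maximum the left side stays and the right
  side does not decrease.\<close>

lemma hmax_le_restart:
  assumes "1 \<le> t"
  shows "hmax x t \<le> hmax x (restart x t) * B_sum x t"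
  using assms
proof (induction t rule: nat_induct_at_least)
  case base
  then show ?case using B_sum_one by simp
next
  case (Suc n)
  let ?\<tau> = "restart x n"
  have \<tau>: "0 < hmax x ?\<tau>" using restart_bounds[OF Suc.hyps] by (intro hmax_pos) simp
  show ?case
  proof (cases "hmax x (Suc n) / hmax x ?\<tau> > B_sum x n + 1")
    case True
    have "hmax x (Suc n) * 1 \<le> hmax x (Suc n) * B_sum x (Suc n)"
      using hmax_pos[of "Suc n"] B_sum_ge_one[of "Suc n"] by (intro mult_left_mono) auto
    then show ?thesis using True by simp
  next
    case False
    then have le: "hmax x (Suc n) \<le> hmax x ?\<tau> * (B_sum x n + 1)"
      using \<tau> by (simp add: field_simps)
    show ?thesis
    proof (cases "hmax x (Suc n) = \<bar>x (Suc n)\<bar>")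
      case True
      then have "B_sum x (Suc n) = B_sum x n + 1"
        using hmax_pos[of "Suc n"] by (simp add: B_sum_Suc)
      then show ?thesis using le False by simp
    next
      case no_max: False
      then have "hmax x (Suc n) = hmax x n" using hmax_Suc[OF Suc.hyps, of x] by (auto simp: max_def split: if_splits)
      also have "\<dots> \<le> hmax x ?\<tau> * B_sum x n" by (rule Suc.IH)
      also have "\<dots> \<le> hmax x ?\<tau> * B_sum x (Suc n)"
        using \<tau> B_sum_mono[of n "Suc n"] by (intro mult_left_mono) auto
      finally show ?thesis using False by simp
    qed
  qed
qed

text \<open>By \<open>hmax_le_restart\<close> the restart test can succeed only if the maximum
  strictly increases. Then the new ratio \<open>\<bar>x s\<bar> / hmax x s\<close> is 1.\<close>

lemma restart_Suc:
  assumes "1 \<le> n" "restart x (Suc n) = Suc n"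
  shows "hmax x (restart x n) * (B_sum x n + 1) < hmax x (Suc n)"
    and "B_sum x (Suc n) = B_sum x n + 1"
proof -
  have \<tau>: "0 < hmax x (restart x n)" "restart x n \<noteq> Suc n"
    using restart_bounds[OF assms(1), of x] by (auto intro: hmax_pos)
  show gt: "hmax x (restart x n) * (B_sum x n + 1) < hmax x (Suc n)"
    using assms(2) \<tau> by (auto simp: field_simps split: if_splits)
  then have "hmax x n < hmax x (Suc n)"
    using hmax_le_restart[OF assms(1)] \<tau>(1) by (simp add: algebra_simps)
  then have "hmax x (Suc n) = \<bar>x (Suc n)\<bar>"
    using hmax_Suc[OF assms(1), of x] by (simp add: max_def split: if_splits)
  then show "B_sum x (Suc n) = B_sum x n + 1"
    using hmax_pos[of "Suc n"] by (simp add: B_sum_Suc)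
qed

lemma sum_abs_le: 
  assumes "1 \<le> t"
  shows "(\<Sum>s = 1..t. \<bar>x s\<bar>) \<le> hmax x t * B_sum x t"
proof -
  have "(\<Sum>s = 1..t. \<bar>x s\<bar>) \<le> (\<Sum>s = 1..t. hmax x t * (\<bar>x s\<bar> / hmax x s))"
  proof (rule sum_mono)
    fix s assume s: "s \<in> {1..t}"
    have "\<bar>x s\<bar> = hmax x s * (\<bar>x s\<bar> / hmax x s)" using s hmax_pos[of s] by simp
    also have "\<dots> \<le> hmax x t * (\<bar>x s\<bar> / hmax x s)"
      using s ratio_bounds[of s] hmax_mono[of s t x] by (intro mult_right_mono) auto
    finally show "\<bar>x s\<bar> \<le> hmax x t * (\<bar>x s\<bar> / hmax x s)" .
  qed
  then show ?thesis by (simp add: B_sum_def sum_distrib_left)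
qed

text \<open>Two restarts bound the total length of the rounds before the first of them by the scale at
  the second, so only the last two epochs matter for the comparator.\<close>

lemma sum_abs_before_le:
  assumes "1 \<le> n" "restart x (Suc n) = Suc n"
  shows "(\<Sum>s = 1..<restart x n. \<bar>x s\<bar>) \<le> hmax x (Suc n)"
proof -
  let ?\<tau> = "restart x n"
  have \<tau>: "1 \<le> ?\<tau>" "?\<tau> \<le> n" using restart_bounds[OF assms(1)] by auto
  have "(\<Sum>s = 1..<?\<tau>. \<bar>x s\<bar>) \<le> (\<Sum>s = 1..?\<tau>. \<bar>x s\<bar>)" by (intro sum_mono2) auto
  also have "\<dots> \<le> hmax x ?\<tau> * B_sum x ?\<tau>" using \<tau>(1) by (rule sum_abs_le)
  also have "\<dots> \<le> hmax x ?\<tau> * (B_sum x n + 1)"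
    using B_sum_mono[OF \<tau>(2)] hmax_pos[OF \<tau>(1)] by (intro mult_left_mono) auto
  also have "\<dots> \<le> hmax x (Suc n)" using restart_Suc(1)[OF assms] by simp
  finally show ?thesis .
qed

text \<open>From \<open>B_sum x t \<le> t\<close> and the formula for the sum of squares. The bound
  \<open>T ^ 5\<close> uses \<open>3 * T + 1 \<le> T\<^sup>2\<close>, true from 4 on. For constant
  nonzero \<open>x\<close> the value is \<open>T ^ 3 * (T + 1) * (2 * T + 1) / 3\<close>, which
  exceeds \<open>T ^ 5\<close> for \<open>T\<close> = 1, 2, 3; hence the factor 2 in
  general.\<close>

lemma c_sum_le:
  "c_sum x T \<le> 2 * real T ^ 5" "4 \<le> T \<Longrightarrow> c_sum x T \<le> real T ^ 5"
proof -
  have B0: "0 \<le> B_sum x t" for t using B_sum_mono[of 0 t] by (simp add: B_sum_def)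
  have B2: "(B_sum x t)\<^sup>2 \<le> (real t)\<^sup>2" for t using B0 B_sum_le by (intro power_mono)
  have squares: "(\<Sum>t = 1..T. (real t)\<^sup>2) = real T * (real T + 1) * (2 * real T + 1) / 6"
    by (induction T) (auto simp: field_simps power2_eq_square)
  have "c_sum x T \<le> 2 * (real T)\<^sup>2 * (\<Sum>t = 1..T. (real t)\<^sup>2)"
    unfolding c_sum_def using B2 by (intro mult_mono sum_mono) (auto intro: sum_nonneg)
  also have "\<dots> = real T ^ 3 * (2 * (real T)\<^sup>2 + 3 * real T + 1) / 3"
    unfolding squares by (simp add: field_simps eval_nat_numeral)
  finally have c: "c_sum x T \<le> real T ^ 3 * ((2 * (real T)\<^sup>2 + 3 * real T + 1) / 3)" by simp
  have *: "c_sum x T \<le> a * real T ^ 5" if "(2 * (real T)\<^sup>2 + 3 * real T + 1) / 3 \<le> a * (real T)\<^sup>2" for a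
  proof -
    have "real T ^ 3 * ((2 * (real T)\<^sup>2 + 3 * real T + 1) / 3) \<le> real T ^ 3 * (a * (real T)\<^sup>2)"
      using that by (intro mult_left_mono) auto
    then show ?thesis using c by (simp add: eval_nat_numeral mult_ac)
  qed
  show "c_sum x T \<le> 2 * real T ^ 5"
  proof (cases "T = 0")
    case False
    then have "1 \<le> real T" by simp
    moreover from this have "1 * real T \<le> real T * real T" by (intro mult_right_mono) auto
    ultimately have "3 * real T + 1 \<le> 4 * (real T * real T)" by linarith
    then show ?thesis by (intro *) (simp add: power2_eq_square)
  qed (simp add: c_sum_def)
  show "c_sum x T \<le> real T ^ 5" if "4 \<le> T"
  proof -
    have "4 * real T \<le> real T * real T" using that by (intro mult_right_mono) auto
    moreover have "4 \<le> real T" using that by simp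
    ultimately have "3 * real T + 1 \<le> real T * real T" by linarith
    then show ?thesis using *[of 1] by (simp add: power2_eq_square)
  qed
qed

end

section \<open>Regret\<close>

lemma w_hat_eq:
  fixes x \<delta> t
  defines "\<tau> \<equiv> restart x t"
  defines "V \<equiv> (hmax x \<tau>)\<^sup>2 + (\<Sum>s = \<tau>..<t. (\<delta> s * x s)\<^sup>2)"
    and "G \<equiv> \<Sum>s = \<tau>..<t. \<delta> s * x s"
  shows "w_hat x \<delta> t = - ((hmax x \<tau>)\<^sup>2 * (potential (hmax x t) V G * slope (hmax x t) V G))"
  unfolding w_hat_def Let_def potential_def slope_def \<tau>_def[symmetric] V_def[symmetric] G_def[symmetric]
  by (simp add: mult_ac)

section \<open>Regret within one epoch\<close>

text \<open>The loss enters the regret analysis through this bound on its subgradients, which the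
  Lipschitz condition provides.\<close>

locale play = rounds +
  fixes \<delta> :: "nat \<Rightarrow> real" and T :: nat
  assumes \<delta>_bound: "t \<in> {1..T} \<Longrightarrow> \<bar>\<delta> t\<bar> \<le> 1"
begin

abbreviation "g s \<equiv> \<delta> s * x s"

lemma abs_g_le: "t \<in> {1..T} \<Longrightarrow> \<bar>g t\<bar> \<le> \<bar>x t\<bar>"
  using \<delta>_bound by (simp add: abs_mult mult_left_le_one_le)

text \<open>Induction over the rounds of an epoch; before the first one the potential term is
  \<open>\<eta>\<^sup>2 / \<eta>\<close>. The scale \<open>h\<close> is general because round
  \<open>t\<close> needs the hypothesis at \<open>hmax x t\<close>, the scale of its prediction, and
  later rounds may use a larger one. The sums are half-open, so \<open>t = Suc T\<close> includes
  round \<open>T\<close>.\<close>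

lemma epoch_potential:
  assumes \<tau>: "1 \<le> \<tau>" "\<tau> \<le> t" and t: "t \<le> Suc T"
    and epoch: "\<And>s. s \<in> {\<tau>..<t} \<Longrightarrow> restart x s = \<tau>"
    and h: "0 < h" "\<And>s. s \<in> {\<tau>..<t} \<Longrightarrow> hmax x s \<le> h"
  shows "(\<Sum>s = \<tau>..<t. g s * w_hat x \<delta> s)
    + (hmax x \<tau>)\<^sup>2 * potential h ((hmax x \<tau>)\<^sup>2 + (\<Sum>s = \<tau>..<t. (g s)\<^sup>2)) (\<Sum>s = \<tau>..<t. g s)
    \<le> hmax x \<tau>"
  using \<tau>(2) t epoch h
proof (induction t arbitrary: h rule: dec_induct)
  case base
  then show ?case using hmax_pos[OF \<tau>(1)] by (simp add: potential_def power2_eq_square)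
next
  case (step t)
  define V G where "V = (hmax x \<tau>)\<^sup>2 + (\<Sum>s = \<tau>..<t. (g s)\<^sup>2)" and "G = (\<Sum>s = \<tau>..<t. g s)"
  let ?\<eta> = "hmax x \<tau>" and ?h = "hmax x t"
  have t: "1 \<le> t" "t \<in> {1..T}" "t \<in> {\<tau>..<Suc t}" using \<tau> step by auto
  have V: "0 < V" using hmax_pos[OF \<tau>(1)] by (simp add: V_def add_pos_nonneg sum_nonneg)
  have V': "0 < V + (g t)\<^sup>2" using V by (simp add: add_pos_nonneg)
  have IH: "(\<Sum>s = \<tau>..<t. g s * w_hat x \<delta> s) + ?\<eta>\<^sup>2 * potential ?h V G \<le> ?\<eta>"
    unfolding V_def G_def using step.prems \<tau> by (intro step.IH) (auto intro: hmax_pos[OF t(1)] hmax_mono)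
  have w: "w_hat x \<delta> t = - (?\<eta>\<^sup>2 * (potential ?h V G * slope ?h V G))"
    using step.prems(2)[OF t(3)] by (simp only: w_hat_eq V_def G_def)
  have "potential h (V + (g t)\<^sup>2) (G + g t) \<le> potential ?h (V + (g t)\<^sup>2) (G + g t)"
    using step.prems(4)[OF t(3)] hmax_pos[OF t(1)] V' by (rule potential_antimono_scale)
  also have "\<dots> \<le> potential ?h V G * (1 + g t * slope ?h V G)"
    using abs_g_le[OF t(2)] abs_le_hmax[OF t(1) order_refl, of x] hmax_pos[OF t(1)] V
    by (intro potential_step) auto
  finally have "?\<eta>\<^sup>2 * potential h (V + (g t)\<^sup>2) (G + g t)
      \<le> ?\<eta>\<^sup>2 * (potential ?h V G * (1 + g t * slope ?h V G))"
    by (intro mult_left_mono) auto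
  also have "\<dots> = ?\<eta>\<^sup>2 * potential ?h V G - g t * w_hat x \<delta> t" by (simp add: w algebra_simps)
  finally show ?case using IH step(1) by (simp add: V_def G_def add_ac)
qed

text \<open>Throughout \<open>{\<tau>..t}\<close> the restart index is \<open>\<tau>\<close>, so
  \<open>u_hat\<close> is \<open>w_hat\<close> divided by the constant
  \<open>hmax x \<tau> * B_sum x \<tau>\<close>, and \<open>epoch_potential\<close> is divided by
  it.\<close>

lemma epoch_regret_zero:
  fixes t
  assumes t: "t \<in> {1..T}"
  defines "\<tau> \<equiv> restart x t"
  defines "V \<equiv> (hmax x \<tau>)\<^sup>2 + (\<Sum>s = \<tau>..t. (g s)\<^sup>2)" and "G \<equiv> \<Sum>s = \<tau>..t. g s"
  shows "(\<Sum>s = \<tau>..t. g s * u_hat x \<delta> s)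
    \<le> 1 / B_sum x \<tau> - hmax x \<tau> / (B_sum x \<tau> * sqrt V) * exp (G\<^sup>2 / (2 * V + 2 * hmax x T * \<bar>G\<bar>))"
proof -
  let ?\<eta> = "hmax x \<tau>" and ?B = "B_sum x \<tau>"
  have \<tau>: "1 \<le> \<tau>" "\<tau> \<le> t" using restart_bounds[of t x] t by (auto simp: \<tau>_def)
  have pos: "0 < ?\<eta>" "0 < ?B" using hmax_pos[OF \<tau>(1)] B_sum_ge_one[OF \<tau>(1)] by auto
  have epoch: "restart x s = \<tau>" if "s \<in> {\<tau>..t}" for s
    using that restart_eq_between[of x t s] by (auto simp: \<tau>_def)
  have "(\<Sum>s = \<tau>..<Suc t. g s * w_hat x \<delta> s)
      + ?\<eta>\<^sup>2 * potential (hmax x T) (?\<eta>\<^sup>2 + (\<Sum>s = \<tau>..<Suc t. (g s)\<^sup>2)) (\<Sum>s = \<tau>..<Suc t. g s) \<le> ?\<eta>"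
    using \<tau> t epoch by (intro epoch_potential) (auto intro: hmax_pos hmax_mono)
  then have *: "(\<Sum>s = \<tau>..t. g s * w_hat x \<delta> s) + ?\<eta>\<^sup>2 * potential (hmax x T) V G \<le> ?\<eta>"
    by (simp add: atLeastLessThanSuc_atLeastAtMost V_def G_def)
  have "(\<Sum>s = \<tau>..t. g s * u_hat x \<delta> s) = (\<Sum>s = \<tau>..t. g s * w_hat x \<delta> s) / (?\<eta> * ?B)"
    unfolding sum_divide_distrib
    by (intro sum.cong) (auto simp: u_hat_def epoch divide_inverse)
  also have "\<dots> \<le> (?\<eta> - ?\<eta>\<^sup>2 * potential (hmax x T) V G) / (?\<eta> * ?B)"
    using * pos by (intro divide_right_mono) auto
  also have "\<dots> = 1 / ?B - ?\<eta> / (?B * sqrt V) * exp (G\<^sup>2 / (2 * V + 2 * hmax x T * \<bar>G\<bar>))"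
    using pos by (simp add: potential_def diff_divide_distrib power2_eq_square)
  finally show ?thesis .
qed

lemma epoch_regret_zero_le:
  assumes "t \<in> {1..T}"
  shows "(\<Sum>s = restart x t..t. g s * u_hat x \<delta> s) \<le> 1 / B_sum x (restart x t)"
proof -
  have \<tau>: "1 \<le> restart x t" using restart_bounds[of t x] assms by auto
  have "0 < B_sum x (restart x t)" "0 < hmax x (restart x t)"
    using hmax_pos[OF \<tau>] B_sum_ge_one[OF \<tau>] by auto
  then show ?thesis
    by (intro order_trans[OF epoch_regret_zero[OF assms]]) (simp add: sum_nonneg)
qed

lemma sum_B_sum_squares_ge: "real T \<le> (\<Sum>t = 1..T. (B_sum x t)\<^sup>2)"
proof -
  have "(\<Sum>t = 1..T. 1) \<le> (\<Sum>t = 1..T. (B_sum x t)\<^sup>2)"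
    using B_sum_ge_one by (intro sum_mono) (auto intro: one_le_power)
  then show ?thesis by simp
qed

text \<open>Both bounds are Cauchy-Schwarz. The first uses that the epoch length is at most
  \<open>T \<le> C\<close>. The second uses
  \<open>\<bar>g s\<bar> \<le> hmax x \<tau> * (r s * B_sum x s)\<close>, a consequence of
  \<open>hmax_le_restart\<close>, and \<open>(r s)\<^sup>2 \<le> r s\<close>.\<close>

lemma epoch_gradient_sum:
  fixes t
  assumes t: "t \<in> {1..T}"
  defines "\<tau> \<equiv> restart x t"
  defines "G \<equiv> \<Sum>s = \<tau>..t. g s" and "C \<equiv> \<Sum>s = 1..T. (B_sum x s)\<^sup>2"
  shows "G\<^sup>2 \<le> C * (\<Sum>s = \<tau>..t. (g s)\<^sup>2)"
    and "G\<^sup>2 \<le> (hmax x \<tau>)\<^sup>2 * B_sum x T * C"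
proof -
  have \<tau>: "1 \<le> \<tau>" "\<tau> \<le> t" using restart_bounds[of t x] t by (auto simp: \<tau>_def)
  have sub: "{\<tau>..t} \<subseteq> {1..T}" using \<tau> t by auto
  have \<eta>: "0 < hmax x \<tau>" using \<tau>(1) by (rule hmax_pos)
  have "G\<^sup>2 \<le> (\<Sum>s = \<tau>..t. (g s)\<^sup>2) * card {\<tau>..t}"
    unfolding G_def by (rule sum_squared_le_sum_of_squares)
  also have "\<dots> \<le> (\<Sum>s = \<tau>..t. (g s)\<^sup>2) * C"
  proof (rule mult_left_mono)
    have "real (card {\<tau>..t}) \<le> real T" using sub card_mono[of "{1..T}" "{\<tau>..t}"] by simp
    then show "real (card {\<tau>..t}) \<le> C" using sum_B_sum_squares_ge by (simp add: C_def)
  qed (simp add: sum_nonneg)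
  finally show "G\<^sup>2 \<le> C * (\<Sum>s = \<tau>..t. (g s)\<^sup>2)" by (simp add: mult.commute)

  define r where "r s = \<bar>x s\<bar> / hmax x s" for s
  have r: "0 \<le> r s" "r s \<le> 1" if "s \<in> {1..T}" for s using ratio_bounds[of s] that by (auto simp: r_def)
  have B0: "0 \<le> B_sum x s" for s using B_sum_mono[of 0 s] by (simp add: B_sum_def)
  have "\<bar>G\<bar> \<le> (\<Sum>s = \<tau>..t. \<bar>g s\<bar>)" unfolding G_def by (rule sum_abs)
  also have "\<dots> \<le> (\<Sum>s = \<tau>..t. hmax x \<tau> * (r s * B_sum x s))"
  proof (rule sum_mono)
    fix s assume s: "s \<in> {\<tau>..t}"
    then have s1: "s \<in> {1..T}" using sub by auto
    have "restart x s = \<tau>" using s restart_eq_between[of x t s] by (auto simp: \<tau>_def)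
    then have "hmax x s \<le> hmax x \<tau> * B_sum x s" using hmax_le_restart[of s] s1 by auto
    then have "r s * hmax x s \<le> r s * (hmax x \<tau> * B_sum x s)"
      using r[OF s1] by (intro mult_left_mono)
    moreover have "r s * hmax x s = \<bar>x s\<bar>" using hmax_pos[of s] s1 by (simp add: r_def)
    ultimately show "\<bar>g s\<bar> \<le> hmax x \<tau> * (r s * B_sum x s)"
      using abs_g_le[OF s1] by (simp add: mult_ac)
  qed
  also have "\<dots> = hmax x \<tau> * (\<Sum>s = \<tau>..t. r s * B_sum x s)" by (simp add: sum_distrib_left)
  also have "\<dots> \<le> hmax x \<tau> * (\<Sum>s = 1..T. r s * B_sum x s)"
    using \<eta> sub r B0 by (intro mult_left_mono sum_mono2) auto
  finally have "\<bar>G\<bar>\<^sup>2 \<le> (hmax x \<tau> * (\<Sum>s = 1..T. r s * B_sum x s))\<^sup>2"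
    by (intro power_mono) auto
  also have "\<dots> = (hmax x \<tau>)\<^sup>2 * (\<Sum>s = 1..T. r s * B_sum x s)\<^sup>2" by (simp add: power_mult_distrib)
  also have "\<dots> \<le> (hmax x \<tau>)\<^sup>2 * ((\<Sum>s = 1..T. (r s)\<^sup>2) * C)"
    unfolding C_def by (intro mult_left_mono Cauchy_Schwarz_ineq_sum) simp
  also have "(\<Sum>s = 1..T. (r s)\<^sup>2) \<le> B_sum x T"
    unfolding B_sum_def r_def[symmetric] power2_eq_square
    using r by (intro sum_mono) (simp add: mult_left_le)
  finally show "G\<^sup>2 \<le> (hmax x \<tau>)\<^sup>2 * B_sum x T * C"
    by (simp add: C_def sum_nonneg mult_right_mono mult_left_mono mult.assoc)
qed

lemma sum_squares_le_V_sum: 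
  assumes "A \<subseteq> {1..T}"
  shows "(\<Sum>s\<in>A. (g s)\<^sup>2) \<le> V_sum x \<delta> T"
proof -
  have "(\<Sum>s\<in>A. (g s)\<^sup>2) \<le> (\<Sum>s = 1..T. (g s)\<^sup>2)" using assms by (intro sum_mono2) auto
  then show ?thesis by (simp add: V_sum_def power_mult_distrib add_increasing)
qed

text \<open>The potential left over in \<open>epoch_regret_zero\<close> is the term subtracted in
  \<open>comparator_cost_le\<close>. The root keeps the squares of this epoch only, so those of two
  epochs can later be added.\<close>

lemma epoch_regret:
  fixes t w
  assumes t: "t \<in> {1..T}"
  defines "\<tau> \<equiv> restart x t"
  defines "Y \<equiv> ln_plus (2 * \<bar>w\<bar> * sqrt (2 * V_sum x \<delta> T * c_sum x T))"
    and "Z \<equiv> ln_plus (2 * \<bar>w\<bar>\<^sup>2 * V_sum x \<delta> T * c_sum x T)"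
  shows "(\<Sum>s = \<tau>..t. g s * (u_hat x \<delta> s - w))
    \<le> 1 / B_sum x \<tau> + 1 / 2 + \<bar>w\<bar> * (7 * hmax x T * Y + sqrt (2 * (\<Sum>s = \<tau>..t. (g s)\<^sup>2) * Z))"
proof -
  define G S where "G = (\<Sum>s = \<tau>..t. g s)" and "S = (\<Sum>s = \<tau>..t. (g s)\<^sup>2)"
  have \<tau>: "1 \<le> \<tau>" "\<tau> \<le> t" using restart_bounds[of t x] t by (auto simp: \<tau>_def)
  have "\<bar>w\<bar> * \<bar>G\<bar> - hmax x \<tau> / (B_sum x \<tau> * sqrt ((hmax x \<tau>)\<^sup>2 + S))
        * exp (G\<^sup>2 / (2 * ((hmax x \<tau>)\<^sup>2 + S) + 2 * hmax x T * \<bar>G\<bar>))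
      \<le> 1 / 2 + \<bar>w\<bar> * (7 * hmax x T * Y + sqrt (2 * S * Z))"
    unfolding Y_def Z_def c_sum_def
  proof (rule comparator_cost_le)
    show "0 < hmax x \<tau>" "hmax x \<tau> \<le> hmax x T" using \<tau> t by (auto intro: hmax_pos hmax_mono)
    show "0 \<le> S" "S \<le> V_sum x \<delta> T"
      unfolding S_def using \<tau> t by (auto intro!: sum_nonneg sum_squares_le_V_sum)
    show "0 < B_sum x \<tau>" "B_sum x \<tau> \<le> B_sum x T" "1 \<le> B_sum x T"
      using B_sum_ge_one[OF \<tau>(1)] B_sum_ge_one[of T] B_sum_mono[of \<tau> T] \<tau> t by auto
    show "G\<^sup>2 \<le> (\<Sum>s = 1..T. (B_sum x s)\<^sup>2) * S"
      "G\<^sup>2 \<le> (hmax x \<tau>)\<^sup>2 * B_sum x T * (\<Sum>s = 1..T. (B_sum x s)\<^sup>2)"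
      unfolding G_def S_def \<tau>_def using epoch_gradient_sum[OF t] by auto
  qed
  moreover have "(\<Sum>s = \<tau>..t. g s * u_hat x \<delta> s) \<le> 1 / B_sum x \<tau>
      - hmax x \<tau> / (B_sum x \<tau> * sqrt ((hmax x \<tau>)\<^sup>2 + S))
        * exp (G\<^sup>2 / (2 * ((hmax x \<tau>)\<^sup>2 + S) + 2 * hmax x T * \<bar>G\<bar>))"
    unfolding G_def S_def \<tau>_def by (rule epoch_regret_zero[OF t])
  moreover have "(\<Sum>s = \<tau>..t. g s * (u_hat x \<delta> s - w)) = (\<Sum>s = \<tau>..t. g s * u_hat x \<delta> s) - G * w"
    by (simp add: G_def right_diff_distrib sum_subtractf sum_distrib_right)
  moreover have "- (G * w) \<le> \<bar>w\<bar> * \<bar>G\<bar>" using abs_ge_minus_self[of "G * w"] by (simp add: abs_mult mult.commute)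
  ultimately show ?thesis unfolding S_def[symmetric] by linarith
qed

section \<open>Summation over the epochs\<close>

lemma restart_restart: "1 \<le> t \<Longrightarrow> restart x (restart x t) = restart x t"
  using restart_bounds[of t x] by (intro restart_eq_between) auto

text \<open>A restart raises \<open>B_sum\<close> by one, and
  \<open>1 / (b + 1) \<le> ln ((b + 1) / b)\<close>; the costs of the epochs then telescope.\<close>

lemma inverse_B_sum_le_ln_diff:
  assumes "1 \<le> n" "restart x (Suc n) = Suc n"
  shows "ln (B_sum x n) + 1 / B_sum x (Suc n) \<le> ln (B_sum x (Suc n))"
proof -
  have pos: "0 < B_sum x n" using B_sum_ge_one[OF assms(1)] by simp
  have B: "B_sum x (Suc n) = B_sum x n + 1" using assms by (rule restart_Suc(2))
  have "ln (B_sum x n / B_sum x (Suc n)) \<le> B_sum x n / B_sum x (Suc n) - 1"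
    using pos B by (intro ln_le_minus_one) auto
  moreover have "B_sum x n / B_sum x (Suc n) - 1 = - (1 / B_sum x (Suc n))"
    using pos by (simp add: B field_simps)
  ultimately show ?thesis using pos B by (simp add: ln_div)
qed

text \<open>Induction from one restart to the previous one. The left side already contains the cost
  \<open>1 / B_sum x \<tau>\<close> of the epoch about to begin, so the hypothesis at the previous
  restart covers the epoch that ends before \<open>\<tau>\<close>.\<close>

lemma regret_zero_before_restart:
  "1 \<le> \<tau> \<Longrightarrow> \<tau> \<le> T \<Longrightarrow> restart x \<tau> = \<tau> \<Longrightarrow>
    (\<Sum>s = 1..<\<tau>. g s * u_hat x \<delta> s) + 1 / B_sum x \<tau> \<le> 1 + ln (B_sum x \<tau>)"
proof (induction \<tau> rule: less_induct)
  case (less \<tau>)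
  show ?case
  proof (cases "\<tau> = 1")
    case True
    then show ?thesis using B_sum_one by simp
  next
    case False
    then obtain n where n: "\<tau> = Suc n" "1 \<le> n" using less.prems by (cases \<tau>) auto
    define \<sigma> where "\<sigma> = restart x n"
    have \<sigma>: "1 \<le> \<sigma>" "\<sigma> \<le> n" "restart x \<sigma> = \<sigma>"
      using restart_bounds[OF n(2), of x] restart_restart[OF n(2)] by (auto simp: \<sigma>_def)
    have pos: "0 < B_sum x \<sigma>" "0 < B_sum x n"
      using B_sum_ge_one[OF \<sigma>(1)] B_sum_ge_one[OF n(2)] by auto
    have "(\<Sum>s = 1..<\<tau>. g s * u_hat x \<delta> s)
        = (\<Sum>s = 1..<\<sigma>. g s * u_hat x \<delta> s) + (\<Sum>s = \<sigma>..<\<tau>. g s * u_hat x \<delta> s)"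
      using \<sigma> n by (simp add: sum.atLeastLessThan_concat)
    also have "(\<Sum>s = \<sigma>..<\<tau>. g s * u_hat x \<delta> s) \<le> 1 / B_sum x \<sigma>"
      using epoch_regret_zero_le[of n] n less.prems
      by (simp add: \<sigma>_def atLeastLessThanSuc_atLeastAtMost)
    also have "(\<Sum>s = 1..<\<sigma>. g s * u_hat x \<delta> s) + 1 / B_sum x \<sigma> \<le> 1 + ln (B_sum x \<sigma>)"
      using \<sigma> n less.prems by (intro less.IH) auto
    also have "\<dots> \<le> 1 + ln (B_sum x n)" using pos B_sum_mono[OF \<sigma>(2)] by simp
    finally have "(\<Sum>s = 1..<\<tau>. g s * u_hat x \<delta> s) \<le> 1 + ln (B_sum x n)" by simp
    then show ?thesis using inverse_B_sum_le_ln_diff[OF n(2)] n less.prems by simp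
  qed
qed

text \<open>The last two epochs begin at \<open>\<sigma>\<close> and \<open>\<tau>\<close>. Each
  contributes 7 to the 14 and \<open>1 / 2\<close> to the constant 2, whose other unit comes from
  \<open>regret_zero_before_restart\<close>. Before \<open>\<sigma>\<close> the comparator costs at
  most the total length times \<open>\<bar>w\<bar>\<close>, which gives the \<open>+ 1\<close>
  beside the 14.\<close>

lemma regret_bound:
  assumes T: "1 \<le> T"
  shows "(\<Sum>t = 1..T. g t * (u_hat x \<delta> t - w))
        \<le> 2 * \<bar>w\<bar> * sqrt (V_sum x \<delta> T * ln_plus (2 * \<bar>w\<bar>\<^sup>2 * V_sum x \<delta> T * c_sum x T))
          + hmax x T * \<bar>w\<bar> * (14 * ln_plus (2 * \<bar>w\<bar> * sqrt (2 * V_sum x \<delta> T * c_sum x T)) + 1)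
          + 2 + ln (B_sum x T)"
proof -
  define Q Y Z h where "Q = V_sum x \<delta> T"
    and "Y = ln_plus (2 * \<bar>w\<bar> * sqrt (2 * V_sum x \<delta> T * c_sum x T))"
    and "Z = ln_plus (2 * \<bar>w\<bar>\<^sup>2 * V_sum x \<delta> T * c_sum x T)"
    and "h = hmax x T"
  define \<tau> where "\<tau> = restart x T"
  define R where "R s = g s * (u_hat x \<delta> s - w)" for s
  define S where "S A = (\<Sum>s\<in>A. (g s)\<^sup>2)" for A
  have YZ: "0 \<le> Y" "0 \<le> Z" by (simp_all add: Y_def Z_def ln_plus_def)
  have h: "0 < h" using hmax_pos[OF T] by (simp add: h_def)
  have hw: "0 \<le> h * \<bar>w\<bar>" using h by simp
  have S0: "0 \<le> S A" for A by (simp add: S_def sum_nonneg)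
  have \<tau>: "1 \<le> \<tau>" "\<tau> \<le> T" "restart x \<tau> = \<tau>"
    using restart_bounds[OF T, of x] restart_restart[OF T] by (auto simp: \<tau>_def)
  have epoch: "(\<Sum>s = restart x t..t. R s)
      \<le> 1 / B_sum x (restart x t) + 1 / 2 + \<bar>w\<bar> * (7 * h * Y + sqrt (2 * S {restart x t..t} * Z))"
    if "t \<in> {1..T}" for t
    using epoch_regret[OF that, of w] by (simp only: R_def S_def Y_def Z_def h_def)
  have last: "(\<Sum>s = \<tau>..T. R s)
      \<le> 1 / B_sum x \<tau> + 1 / 2 + \<bar>w\<bar> * (7 * h * Y + sqrt (2 * S {\<tau>..T} * Z))"
    using epoch[of T] T by (simp add: \<tau>_def)
  have "(\<Sum>t = 1..T. R t) \<le> 2 * \<bar>w\<bar> * sqrt (Q * Z) + h * \<bar>w\<bar> * (14 * Y + 1) + 2 + ln (B_sum x T)"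
  proof (cases "\<tau> = 1")
    case True
    have "S {1..T} \<le> Q" unfolding S_def Q_def by (rule sum_squares_le_V_sum) simp
    then have "2 * S {1..T} * Z \<le> (4 * Q) * Z"
      using S0[of "{1..T}"] YZ by (intro mult_right_mono) linarith+
    then have "2 * S {1..T} * Z \<le> 4 * (Q * Z)" by simp
    then have "sqrt (2 * S {1..T} * Z) \<le> sqrt (4 * (Q * Z))" by (rule real_sqrt_le_mono)
    also have "\<dots> = 2 * sqrt (Q * Z)" by (simp add: real_sqrt_mult)
    finally have "\<bar>w\<bar> * sqrt (2 * S {1..T} * Z) \<le> \<bar>w\<bar> * (2 * sqrt (Q * Z))"
      by (intro mult_left_mono) auto
    moreover have "0 \<le> ln (B_sum x T)" using B_sum_ge_one[OF T] by simp
    ultimately show ?thesis using last True B_sum_one hw mult_nonneg_nonneg[OF hw YZ(1)]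
      by (simp add: algebra_simps)
  next
    case False
    then obtain n where n: "\<tau> = Suc n" "1 \<le> n" using \<tau> by (cases \<tau>) auto
    define \<sigma> where "\<sigma> = restart x n"
    have \<sigma>: "1 \<le> \<sigma>" "\<sigma> \<le> n" "restart x \<sigma> = \<sigma>"
      using restart_bounds[OF n(2), of x] restart_restart[OF n(2)] by (auto simp: \<sigma>_def)
    have split: "(\<Sum>t = 1..T. R t) = (\<Sum>s = 1..<\<sigma>. R s) + (\<Sum>s = \<sigma>..n. R s) + (\<Sum>s = \<tau>..T. R s)"
    proof -
      have "sum R {1..<\<sigma>} + sum R {\<sigma>..<\<tau>} = sum R {1..<\<tau>}"
        "sum R {1..<\<tau>} + sum R {\<tau>..<Suc T} = sum R {1..<Suc T}"
        using \<sigma> n \<tau> by (intro sum.atLeastLessThan_concat; simp)+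
      then show ?thesis by (simp only: n atLeastLessThanSuc_atLeastAtMost)
    qed
    have middle: "(\<Sum>s = \<sigma>..n. R s)
        \<le> 1 / B_sum x \<sigma> + 1 / 2 + \<bar>w\<bar> * (7 * h * Y + sqrt (2 * S {\<sigma>..n} * Z))"
      using epoch[of n] n \<tau> by (simp add: \<sigma>_def)
    have initial: "(\<Sum>s = 1..<\<sigma>. R s) \<le> (\<Sum>s = 1..<\<sigma>. g s * u_hat x \<delta> s) + h * \<bar>w\<bar>"
    proof -
      have "(\<Sum>s = 1..<\<sigma>. R s) = (\<Sum>s = 1..<\<sigma>. g s * u_hat x \<delta> s) + (\<Sum>s = 1..<\<sigma>. - (g s * w))"
        by (simp add: R_def right_diff_distrib sum_subtractf sum_negf)
      also have "(\<Sum>s = 1..<\<sigma>. - (g s * w)) \<le> (\<Sum>s = 1..<\<sigma>. \<bar>x s\<bar> * \<bar>w\<bar>)"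
      proof (rule sum_mono)
        fix s assume "s \<in> {1..<\<sigma>}"
        then have "\<bar>g s\<bar> * \<bar>w\<bar> \<le> \<bar>x s\<bar> * \<bar>w\<bar>"
          using \<sigma> n \<tau> abs_g_le[of s] by (intro mult_right_mono) auto
        then show "- (g s * w) \<le> \<bar>x s\<bar> * \<bar>w\<bar>" using abs_ge_minus_self[of "g s * w"] by (simp add: abs_mult)
      qed
      also have "\<dots> = (\<Sum>s = 1..<\<sigma>. \<bar>x s\<bar>) * \<bar>w\<bar>" by (simp add: sum_distrib_right)
      also have "\<dots> \<le> h * \<bar>w\<bar>"
      proof (rule mult_right_mono)
        have "(\<Sum>s = 1..<\<sigma>. \<bar>x s\<bar>) \<le> hmax x \<tau>"
          using sum_abs_before_le[OF n(2)] \<tau>(3) by (simp add: \<sigma>_def n)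
        also have "\<dots> \<le> h" using \<tau> by (simp add: h_def hmax_mono)
        finally show "(\<Sum>s = 1..<\<sigma>. \<bar>x s\<bar>) \<le> h" .
      qed simp
      finally show ?thesis by simp
    qed
    have "(\<Sum>s = 1..<\<sigma>. g s * u_hat x \<delta> s) + 1 / B_sum x \<sigma> \<le> 1 + ln (B_sum x \<sigma>)"
      using \<sigma> n \<tau> by (intro regret_zero_before_restart) auto
    moreover have "ln (B_sum x \<sigma>) \<le> ln (B_sum x n)"
      using B_sum_ge_one[OF \<sigma>(1)] B_sum_mono[OF \<sigma>(2)] by simp
    moreover have "ln (B_sum x n) + 1 / B_sum x \<tau> \<le> ln (B_sum x T)"
    proof -
      have "ln (B_sum x n) + 1 / B_sum x \<tau> \<le> ln (B_sum x \<tau>)"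
        using inverse_B_sum_le_ln_diff[OF n(2)] n \<tau> by simp
      also have "\<dots> \<le> ln (B_sum x T)" using B_sum_ge_one[OF \<tau>(1)] B_sum_mono[OF \<tau>(2)] by simp
      finally show ?thesis .
    qed
    \<comment> \<open>The two epochs are disjoint, so their squares together are at most
      \<open>Q\<close>; \<open>(a + b)\<^sup>2 \<le> 2 * (a\<^sup>2 + b\<^sup>2)\<close> then merges
      the roots into \<open>sqrt (4 * (Q * Z))\<close>.\<close>
    moreover have "\<bar>w\<bar> * sqrt (2 * S {\<sigma>..n} * Z) + \<bar>w\<bar> * sqrt (2 * S {\<tau>..T} * Z)
        \<le> \<bar>w\<bar> * (2 * sqrt (Q * Z))"
    proof -
      have "S {\<sigma>..n} + S {\<tau>..T} = S ({\<sigma>..n} \<union> {\<tau>..T})"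
        unfolding S_def using n by (intro sum.union_disjoint[symmetric]) auto
      also have "\<dots> \<le> Q" unfolding S_def Q_def using \<sigma> n \<tau> by (intro sum_squares_le_V_sum) auto
      finally have "(S {\<sigma>..n} + S {\<tau>..T}) * Z \<le> Q * Z" using YZ by (intro mult_right_mono)
      then have SQ: "2 * (2 * S {\<sigma>..n} * Z + 2 * S {\<tau>..T} * Z) \<le> 4 * (Q * Z)"
        by (simp add: algebra_simps)
      have "sqrt (2 * S {\<sigma>..n} * Z) + sqrt (2 * S {\<tau>..T} * Z)
          \<le> sqrt (2 * (2 * S {\<sigma>..n} * Z + 2 * S {\<tau>..T} * Z))"
      proof (rule real_le_rsqrt)
        have "(a + b)\<^sup>2 \<le> 2 * (a\<^sup>2 + b\<^sup>2)" for a b :: real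
          using zero_le_power2[of "a - b"] by (simp add: power2_eq_square algebra_simps)
        from this[of "sqrt (2 * S {\<sigma>..n} * Z)" "sqrt (2 * S {\<tau>..T} * Z)"]
        show "(sqrt (2 * S {\<sigma>..n} * Z) + sqrt (2 * S {\<tau>..T} * Z))\<^sup>2
            \<le> 2 * (2 * S {\<sigma>..n} * Z + 2 * S {\<tau>..T} * Z)"
          using S0 YZ by simp
      qed
      also have "\<dots> \<le> sqrt (4 * (Q * Z))" using SQ by (rule real_sqrt_le_mono)
      also have "\<dots> = 2 * sqrt (Q * Z)" by (simp add: real_sqrt_mult)
      finally show ?thesis unfolding distrib_left[symmetric] by (intro mult_left_mono) auto
    qed
    ultimately show ?thesis using split initial middle last by (simp add: algebra_simps)
  qed
  then show ?thesis by (simp add: R_def Q_def Y_def Z_def h_def)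
qed

end

theorem theorem16:
  fixes l :: "real \<Rightarrow> real \<Rightarrow> real"
    and x y \<delta> :: "nat \<Rightarrow> real"
    and w :: real
    and T :: nat
  assumes "\<And>v. convex_on UNIV (l v)"
    and "\<And>v. 1-lipschitz_on UNIV (l v)"
    and "T \<ge> 1"
    and "\<bar>x 1\<bar> > 0"
    and "\<And>t. t \<in> {1..T} \<Longrightarrow> \<delta> t \<in> subdiff_snd l (y t) (x t * u_hat x \<delta> t)"
  shows "(\<Sum>t = 1..T. \<delta> t * x t * (u_hat x \<delta> t - w))
        \<le> 2 * \<bar>w\<bar> * sqrt (V_sum x \<delta> T * ln_plus (2 * \<bar>w\<bar>\<^sup>2 * V_sum x \<delta> T * c_sum x T))
          + hmax x T * \<bar>w\<bar> * (14 * ln_plus (2 * \<bar>w\<bar> * sqrt (2 * V_sum x \<delta> T * c_sum x T)) + 1)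
          + 2 + ln (B_sum x T)
      \<and> B_sum x T \<le> real T
      \<and> (T \<ge> 4 \<longrightarrow> c_sum x T \<le> real T ^ 5)
      \<and> c_sum x T \<le> 2 * real T ^ 5"
proof -
  have "\<bar>\<delta> t\<bar> \<le> 1" if t: "t \<in> {1..T}" for t
  proof -
    let ?v = "x t * u_hat x \<delta> t"
    have sub: "l (y t) z \<ge> l (y t) ?v + \<delta> t * (z - ?v)" for z
      using assms(5)[OF t] by (simp add: subdiff_snd_def)
    have lip: "\<bar>l (y t) z - l (y t) ?v\<bar> \<le> \<bar>z - ?v\<bar>" for z
      using lipschitz_onD[OF assms(2), of z ?v] by (simp add: dist_real_def)
    \<comment> \<open>Testing one unit to the right of the prediction bounds
      \<open>\<delta> t\<close> from above, one unit to the left from below.\<close>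
    show ?thesis using sub[of "?v + 1"] lip[of "?v + 1"] sub[of "?v - 1"] lip[of "?v - 1"] by simp
  qed
  then interpret play x \<delta> T using assms(4) by unfold_locales
  show ?thesis using regret_bound[OF assms(3)] B_sum_le c_sum_le by blast
qed

end
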